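(* For every positive integer $n$, each of the following $45$ statistics $f:S_n\to\mathbb{Z}$ is homomesic with respect to the Lehmer code rotation $\mathcal{L}$ acting on $S_n$ (that is, for each statistic there is a constant $c$, possibly depending on $n$, such that the average of $f$ over every orbit of $\mathcal{L}$ equals $c$). Here $\sigma=\sigma_1\cdots\sigma_n\in S_n$. Statistics related to inversions: (1) the number of inversions $\mathrm{inv}(\sigma)$; (2) the number of non-inversions, i.e. of pairs $i<j$ with $\sigma_i<\sigma_j$; (3) the number of inversions of distance at most $2$, i.e. inversions $(i,j)$ with $j-i\le 2$; (4) the number of inversions of the third entry, $\#\{j>3:\sigma_j<\sigma_3\}$; (5) the number of inversions of the second entry, $\#\{j>2:\sigma_j<\sigma_2\}$. Statistics related to descents: (6) the major index $\mathrm{maj}(\sigma)$; (7) the number of descents; (8) the number of (inner) peaks; (9) the number of left outer peaks; (10) the number of outer peaks; (11) the number of valleys including the boundary; (12) the number of ascents; (13) the number of (inner) valleys; (14) the number of double ascents; (15) the number of double descents; (16) the number of runs; (17) the number of times the permutation switches from increasing to decreasing or from decreasing to increasing; (18) the number of up-down runs; (19) the comajor index; (20) the number of right outer peaks; (21) the number of descents of distance $2$; (22) the number of ascents of distance $2$; (23) the number of odd descents; (24) the number of even descents. Statistics related to patterns: (25)–(30) for each of the six vincular patterns $21\text{-}3$, $13\text{-}2$, $12\text{-}3$, $31\text{-}2$, $23\text{-}1$, $32\text{-}1$, the number of its occurrences; (31) the number of occurrences of $123$ plus the number of occurrences of $132$; (32) the number of occurrences of $213$ plus the number of occurrences of $231$;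 (33) the number of occurrences of $312$ plus the number of occurrences of $321$; (34) the number of occurrences of $14\text{-}2\text{-}3$ or $14\text{-}3\text{-}2$; (35) the number of occurrences of the vincular pattern $|1\text{-}23$. Other statistics: (36) the number of right-to-left maxima; (37) the rank of $\sigma$; (38) the first entry $\sigma_1$; (39) the width of the permutation tree of $\sigma$; (40) the Babson–Steingrímsson statistic $\mathrm{stat}$; (41) the Babson–Steingrímsson statistic $\mathrm{stat}'$; (42) the number of right-to-left minima; (43) $\mathrm{maj}(\sigma)-\mathrm{inv}(\sigma)$; (44) $\mathrm{inv}(\sigma)+\mathrm{maj}(\sigma)$; (45) the number of ascent tops $i$ such that all values smaller than $\sigma_i$ appear before position $i$.
   Context: Homomesy: given a finite set $S$, a bijection $\mathcal{X}:S\to S$ and $f:S\to\mathbb{Z}$, the triple is $c$-mesic (homomesic) if for every orbit $\mathcal{O}$ of $\mathcal{X}$, $\frac{1}{|\mathcal{O}|}\sum_{x\in\mathcal{O}}f(x)=c$. Permutations $\sigma\in S_n$ are written in one-line notation $\sigma_1\cdots\sigma_n$. The Lehmer code of $\sigma$ is $L(\sigma)=(L(\sigma)_1,\dots,L(\sigma)_n)$ with $L(\sigma)_i=\#\{j>i:\sigma_j<\sigma_i\}\in\{0,\dots,n-i\}$; this is a bijection between $S_n$ and such tuples. The Lehmer code rotation $\mathcal{L}:S_n\to S_n$ sends $\sigma$ to the unique $\tau$ with $L(\tau)_i\equiv L(\sigma)_i+1 \pmod{n-i+1}$, $L(\tau)_i\in\{0,\dots,n-i\}$, for all $i$. An inversion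 is a pair of positions $(i,j)$, $i<j$, with $\sigma_i>\sigma_j$. Index $i\in[n-1]$ is a descent if $\sigma_i>\sigma_{i+1}$ and an ascent otherwise. A peak (inner peak) is an index $i$ that is an ascent with $i+1$ a descent; a valley (inner valley) is an index $i$ that is a descent with $i+1$ an ascent. A double ascent is $i$ with $\sigma_i<\sigma_{i+1}<\sigma_{i+2}$; a double descent is $i$ with $\sigma_i>\sigma_{i+1}>\sigma_{i+2}$. A left outer peak is a peak, or the index $1$ if $1$ is a descent; a right outer peak is a peak, or the index $n-1$ if $n-1$ is an ascent; the number of outer peaks is the number of peaks plus $1$ if $1$ is a descent plus $1$ if $n-1$ is an ascent. The number of valleys including the boundary is the number of valleys, plus $1$ if $1$ is an ascent, plus $1$ if $n-1$ is a descent. The number of switches between increasing and decreasing is the number of peaks plus the number of valleys. The number of up-down runs is the number of maximal monotone contiguous subsequences, counting additionally the first entry alone if $1$ is a descent (equivalently, $1+\#\text{peaks}+\#\text{valleys}+[\sigma_1>\sigma_2]$). $\mathrm{maj}(\sigma)=\sum_{i\text{ descent}} i$; the comajor index is $\sum_{i \text{ descent}}(n-i)$. A run is a maximal contiguous increasing subsequence. A descent of distance $2$ is $i\in[n-2]$ with $\sigma_i>\sigma_{i+2}$, otherwise $i$ is an ascent of distance $2$. Odd (even) descents are descents $i$ with $i$ odd (even). An ascent top is a position $i\ge2$ with $\sigma_{i-1}<\sigma_i$. An occurrence of a classical pattern $abc$ is a triple of positions $i_1<i_2<i_3$ with $\sigma_{i_1}\sigma_{i_2}\sigma_{i_3}$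 in the same relative order as $abc$. An occurrence of the vincular pattern $ab\text{-}c$ is such an occurrence with $i_2=i_1+1$; of $a\text{-}bc$, one with $i_3=i_2+1$. An occurrence of $14\text{-}2\text{-}3$ or $14\text{-}3\text{-}2$ is a set of positions $i,i+1,\ell,m$ with $i+1<\ell<m$ and $\sigma_i<\sigma_\ell,\sigma_m<\sigma_{i+1}$. An occurrence of $|1\text{-}23$ is an occurrence of $123$ at positions $1,2,k$. A right-to-left maximum (minimum) is an entry $\sigma_i$ larger (smaller) than all $\sigma_j$ with $j>i$. The rank of $\sigma$ is its position (from $1$ to $n!$) among all permutations of $[n]$ in lexicographic order. The permutation tree of $\sigma$ is the rooted tree on $\{0,\dots,n\}$ with root $0$ in which $\sigma_1$ is a child of the root and, for each $i$, $\sigma_{i+1}$ is attached as a child of the first node smaller than $\sigma_{i+1}$ on the path from $\sigma_i$ to the root; its width is its number of leaves. The Babson–Steingrímsson statistic $\mathrm{stat}$ is the total number of occurrences of $13\text{-}2$, $21\text{-}3$, $32\text{-}1$ plus the number of descents; $\mathrm{stat}'$ is the total number of occurrences of $13\text{-}2$, $31\text{-}2$, $32\text{-}1$ plus the number of descents. *)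

theory Defs
  imports Complex_Main "HOL-Combinatorics.Combinatorics"
begin

section \<open>Homomesy\<close>

definition c_mesic :: "'a set \<Rightarrow> ('a \<Rightarrow> 'a) \<Rightarrow> ('a \<Rightarrow> int) \<Rightarrow> real \<Rightarrow> bool" where
  "c_mesic S X f c \<longleftrightarrow> finite S \<and> bij_betw X S S \<and>
     (\<forall>x\<in>S. (\<Sum>y\<in>orbit X x. real_of_int (f y)) / real (card (orbit X x)) = c)"

definition homomesic :: "'a set \<Rightarrow> ('a \<Rightarrow> 'a) \<Rightarrow> ('a \<Rightarrow> int) \<Rightarrow> bool" where
  "homomesic S X f \<longleftrightarrow> (\<exists>c. c_mesic S X f c)"


section \<open>Permutations and the Lehmer code rotation\<close>

text \<open>
  A permutation of \<open>{1..n}\<close> is a function \<open>\<sigma>\<close> that permutes \<open>{1..n}\<close> (and is the identity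
  elsewhere); the entries of its one-line notation are \<open>\<sigma> 1, \<dots>, \<sigma> n\<close>. Positions are 1-based.
\<close>

definition Sym :: "nat \<Rightarrow> (nat \<Rightarrow> nat) set" where
  "Sym n = {\<sigma>. \<sigma> permutes {1..n}}"

definition lehmer_code :: "nat \<Rightarrow> (nat \<Rightarrow> nat) \<Rightarrow> nat \<Rightarrow> nat" where
  "lehmer_code n \<sigma> i = card {j \<in> {i<..n}. \<sigma> j < \<sigma> i}"

definition lehmer_rotation :: "nat \<Rightarrow> (nat \<Rightarrow> nat) \<Rightarrow> (nat \<Rightarrow> nat)" where
  "lehmer_rotation n \<sigma> = (THE \<tau>. \<tau> \<in> Sym n \<and>
     (\<forall>i\<in>{1..n}. lehmer_code n \<tau> i = (lehmer_code n \<sigma> i + 1) mod (n - i + 1)))"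


section \<open>Inversions, descents, peaks, valleys, runs\<close>

definition inversions :: "nat \<Rightarrow> (nat \<Rightarrow> nat) \<Rightarrow> (nat \<times> nat) set" where
  "inversions n \<sigma> = {(i, j). 1 \<le> i \<and> i < j \<and> j \<le> n \<and> \<sigma> i > \<sigma> j}"

definition noninversions :: "nat \<Rightarrow> (nat \<Rightarrow> nat) \<Rightarrow> (nat \<times> nat) set" where
  "noninversions n \<sigma> = {(i, j). 1 \<le> i \<and> i < j \<and> j \<le> n \<and> \<sigma> i < \<sigma> j}"

definition descents :: "nat \<Rightarrow> (nat \<Rightarrow> nat) \<Rightarrow> nat set" where
  "descents n \<sigma> = {i \<in> {1..<n}. \<sigma> i > \<sigma> (i + 1)}"

definition ascents :: "nat \<Rightarrow> (nat \<Rightarrow> nat) \<Rightarrow> nat set" where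
  "ascents n \<sigma> = {1..<n} - descents n \<sigma>"

definition major_index :: "nat \<Rightarrow> (nat \<Rightarrow> nat) \<Rightarrow> nat" where
  "major_index n \<sigma> = (\<Sum>i\<in>descents n \<sigma>. i)"

definition comajor_index :: "nat \<Rightarrow> (nat \<Rightarrow> nat) \<Rightarrow> nat" where
  "comajor_index n \<sigma> = (\<Sum>i\<in>descents n \<sigma>. n - i)"

definition peaks :: "nat \<Rightarrow> (nat \<Rightarrow> nat) \<Rightarrow> nat set" where
  "peaks n \<sigma> = {i. i \<in> ascents n \<sigma> \<and> i + 1 \<in> descents n \<sigma>}"

definition valleys :: "nat \<Rightarrow> (nat \<Rightarrow> nat) \<Rightarrow> nat set" where
  "valleys n \<sigma> = {i. i \<in> descents n \<sigma> \<and> i + 1 \<in> ascents n \<sigma>}"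

definition left_outer_peaks :: "nat \<Rightarrow> (nat \<Rightarrow> nat) \<Rightarrow> nat set" where
  "left_outer_peaks n \<sigma> = {i. i \<in> peaks n \<sigma> \<or> i = 1 \<and> 1 \<in> descents n \<sigma>}"

definition right_outer_peaks :: "nat \<Rightarrow> (nat \<Rightarrow> nat) \<Rightarrow> nat set" where
  "right_outer_peaks n \<sigma> = {i. i \<in> peaks n \<sigma> \<or> i = n - 1 \<and> n - 1 \<in> ascents n \<sigma>}"

definition num_outer_peaks :: "nat \<Rightarrow> (nat \<Rightarrow> nat) \<Rightarrow> nat" where
  "num_outer_peaks n \<sigma> =
     card (peaks n \<sigma>) + of_bool (1 \<in> descents n \<sigma>) + of_bool (n - 1 \<in> ascents n \<sigma>)"

definition num_valleys_with_boundary :: "nat \<Rightarrow> (nat \<Rightarrow> nat) \<Rightarrow> nat" where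
  "num_valleys_with_boundary n \<sigma> =
     card (valleys n \<sigma>) + of_bool (1 \<in> ascents n \<sigma>) + of_bool (n - 1 \<in> descents n \<sigma>)"

definition double_ascents :: "nat \<Rightarrow> (nat \<Rightarrow> nat) \<Rightarrow> nat set" where
  "double_ascents n \<sigma> = {i. 1 \<le> i \<and> i + 2 \<le> n \<and> \<sigma> i < \<sigma> (i + 1) \<and> \<sigma> (i + 1) < \<sigma> (i + 2)}"

definition double_descents :: "nat \<Rightarrow> (nat \<Rightarrow> nat) \<Rightarrow> nat set" where
  "double_descents n \<sigma> = {i. 1 \<le> i \<and> i + 2 \<le> n \<and> \<sigma> i > \<sigma> (i + 1) \<and> \<sigma> (i + 1) > \<sigma> (i + 2)}"

text \<open>
  A contiguous subsequence \<open>\<sigma> a, \<dots>, \<sigma> b\<close> is identified with the pair \<open>(a, b)\<close>; maximality of a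
  segment is with respect to inclusion among the segments satisfying \<open>P\<close>.
\<close>

definition maximal_segments :: "nat \<Rightarrow> (nat set \<Rightarrow> bool) \<Rightarrow> (nat \<times> nat) set" where
  "maximal_segments n P = {(a, b). 1 \<le> a \<and> a \<le> b \<and> b \<le> n \<and> P {a..b} \<and>
     (\<forall>a' b'. 1 \<le> a' \<and> a' \<le> a \<and> b \<le> b' \<and> b' \<le> n \<and> P {a'..b'} \<longrightarrow> a' = a \<and> b' = b)}"

definition runs :: "nat \<Rightarrow> (nat \<Rightarrow> nat) \<Rightarrow> (nat \<times> nat) set" where
  "runs n \<sigma> = maximal_segments n (\<lambda>A. strict_mono_on A \<sigma>)"

definition num_updown_runs :: "nat \<Rightarrow> (nat \<Rightarrow> nat) \<Rightarrow> nat" where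
  "num_updown_runs n \<sigma> =
     card (maximal_segments n (\<lambda>A. strict_mono_on A \<sigma> \<or> strict_antimono_on A \<sigma>))
     + of_bool (1 \<in> descents n \<sigma>)"

definition descents_dist2 :: "nat \<Rightarrow> (nat \<Rightarrow> nat) \<Rightarrow> nat set" where
  "descents_dist2 n \<sigma> = {i. 1 \<le> i \<and> i + 2 \<le> n \<and> \<sigma> i > \<sigma> (i + 2)}"

definition ascents_dist2 :: "nat \<Rightarrow> (nat \<Rightarrow> nat) \<Rightarrow> nat set" where
  "ascents_dist2 n \<sigma> = {i. 1 \<le> i \<and> i + 2 \<le> n} - descents_dist2 n \<sigma>"


section \<open>Patterns\<close>

definition same_relative_order :: "nat list \<Rightarrow> nat list \<Rightarrow> bool" where
  "same_relative_order xs ys \<longleftrightarrow> length xs = length ys \<and>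
     (\<forall>k<length xs. \<forall>l<length xs. xs ! k < xs ! l \<longleftrightarrow> ys ! k < ys ! l)"

text \<open>Patterns of length three are given as lists, e.g. \<open>[1, 3, 2]\<close> for \<open>132\<close>.\<close>

definition occurrences :: "nat list \<Rightarrow> nat \<Rightarrow> (nat \<Rightarrow> nat) \<Rightarrow> (nat \<times> nat \<times> nat) set" where
  "occurrences p n \<sigma> = {(i, j, k). 1 \<le> i \<and> i < j \<and> j < k \<and> k \<le> n \<and>
     same_relative_order [\<sigma> i, \<sigma> j, \<sigma> k] p}"

text \<open>For a list \<open>[a, b, c]\<close> this counts the vincular pattern \<open>ab-c\<close>.\<close>

definition vinc_occurrences :: "nat list \<Rightarrow> nat \<Rightarrow> (nat \<Rightarrow> nat) \<Rightarrow> (nat \<times> nat \<times> nat) set" where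
  "vinc_occurrences p n \<sigma> = {(i, j, k) \<in> occurrences p n \<sigma>. j = i + 1}"

text \<open>
  Occurrences of \<open>14-2-3\<close> or \<open>14-3-2\<close> at positions \<open>i, i + 1, l, m\<close>.
\<close>

definition occurrences_14_23 :: "nat \<Rightarrow> (nat \<Rightarrow> nat) \<Rightarrow> (nat \<times> nat \<times> nat) set" where
  "occurrences_14_23 n \<sigma> = {(i, l, m). 1 \<le> i \<and> i + 1 < l \<and> l < m \<and> m \<le> n \<and>
     \<sigma> i < \<sigma> l \<and> \<sigma> l < \<sigma> (i + 1) \<and> \<sigma> i < \<sigma> m \<and> \<sigma> m < \<sigma> (i + 1)}"

text \<open>Occurrences of \<open>|1-23\<close>: the first two matched positions are \<open>1\<close> and \<open>2\<close>.\<close>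

definition occurrences_initial_123 :: "nat \<Rightarrow> (nat \<Rightarrow> nat) \<Rightarrow> (nat \<times> nat \<times> nat) set" where
  "occurrences_initial_123 n \<sigma> = {(i, j, k) \<in> occurrences [1, 2, 3] n \<sigma>. i = 1 \<and> j = 2}"

definition bs_stat :: "nat \<Rightarrow> (nat \<Rightarrow> nat) \<Rightarrow> nat" where
  "bs_stat n \<sigma> = card (vinc_occurrences [1, 3, 2] n \<sigma>) + card (vinc_occurrences [2, 1, 3] n \<sigma>)
     + card (vinc_occurrences [3, 2, 1] n \<sigma>) + card (descents n \<sigma>)"

definition bs_stat' :: "nat \<Rightarrow> (nat \<Rightarrow> nat) \<Rightarrow> nat" where
  "bs_stat' n \<sigma> = card (vinc_occurrences [1, 3, 2] n \<sigma>) + card (vinc_occurrences [3, 1, 2] n \<sigma>)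
     + card (vinc_occurrences [3, 2, 1] n \<sigma>) + card (descents n \<sigma>)"


section \<open>Other statistics\<close>

definition rl_maxima :: "nat \<Rightarrow> (nat \<Rightarrow> nat) \<Rightarrow> nat set" where
  "rl_maxima n \<sigma> = {i \<in> {1..n}. \<forall>j\<in>{i<..n}. \<sigma> i > \<sigma> j}"

definition rl_minima :: "nat \<Rightarrow> (nat \<Rightarrow> nat) \<Rightarrow> nat set" where
  "rl_minima n \<sigma> = {i \<in> {1..n}. \<forall>j\<in>{i<..n}. \<sigma> i < \<sigma> j}"

definition one_line :: "nat \<Rightarrow> (nat \<Rightarrow> nat) \<Rightarrow> nat list" where
  "one_line n \<sigma> = map \<sigma> [1..<n + 1]"

definition lex_rank :: "nat \<Rightarrow> (nat \<Rightarrow> nat) \<Rightarrow> nat" where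
  "lex_rank n \<sigma> =
     1 + card {\<tau> \<in> Sym n. (one_line n \<tau>, one_line n \<sigma>) \<in> lexord {(x, y). x < y}}"

text \<open>
  \<open>tree_path \<sigma> i\<close> lists the nodes on the path from \<open>\<sigma> i\<close> (from the root \<open>0\<close> if \<open>i = 0\<close>) to the
  root in the permutation tree. The node \<open>\<sigma> (i + 1)\<close> is attached to the first node on
  \<open>tree_path \<sigma> i\<close> that is smaller than \<open>\<sigma> (i + 1)\<close>; its own path to the root is then
  \<open>\<sigma> (i + 1)\<close> followed by the path from that node. Attaching further nodes does not
  change existing paths.
\<close>

fun tree_path :: "(nat \<Rightarrow> nat) \<Rightarrow> nat \<Rightarrow> nat list" where
  "tree_path \<sigma> 0 = [0]"
| "tree_path \<sigma> (Suc i) = \<sigma> (Suc i) # dropWhile (\<lambda>v. \<not> v < \<sigma> (Suc i)) (tree_path \<sigma> i)"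

text \<open>The parent of the node \<open>\<sigma> i\<close>, for \<open>i \<ge> 1\<close>.\<close>

definition tree_parent :: "(nat \<Rightarrow> nat) \<Rightarrow> nat \<Rightarrow> nat" where
  "tree_parent \<sigma> i = hd (dropWhile (\<lambda>v. \<not> v < \<sigma> i) (tree_path \<sigma> (i - 1)))"

definition tree_leaves :: "nat \<Rightarrow> (nat \<Rightarrow> nat) \<Rightarrow> nat set" where
  "tree_leaves n \<sigma> = {v \<in> {0..n}. \<not> (\<exists>i\<in>{1..n}. tree_parent \<sigma> i = v)}"

definition ascent_tops :: "nat \<Rightarrow> (nat \<Rightarrow> nat) \<Rightarrow> nat set" where
  "ascent_tops n \<sigma> = {i \<in> {2..n}. \<sigma> (i - 1) < \<sigma> i}"

end

theory Submission
  imports Defs "HOL-Number_Theory.Cong"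
begin

text \<open>
  The rotation adds \<open>1\<close> to every entry of the Lehmer code, the \<open>i\<close>-th one modulo \<open>n - i + 1\<close>.
  Hence \<open>n!\<close> is a common period, and a statistic is homomesic as soon as its sum over \<open>n!\<close>
  successive rotations does not depend on the starting point. By the Chinese remainder theorem this
  holds for functions of two adjacent code entries, whose moduli are coprime: the entries started at
  \<open>(a, b)\<close> are a time shift of those started at \<open>(0, 0)\<close>. For three consecutive entries \<open>(a, b, c)\<close>
  the only obstruction is the parity of \<open>a + c\<close>, and it is harmless for functions \<open>g\<close> with
  vanishing alternating sum of \<open>(-1) ^ (a + c) * g a b c\<close>; this is the case for peaks and for
  descents of distance \<open>2\<close>. Every statistic of the theorem is a linear combination of such functions.
\<close>

section \<open>Averaging over orbits\<close>

text \<open>The parity obstruction is real. If the smallest of three consecutive moduli is even,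
  then \<open>(-1) ^ (a + c)\<close> is constant along orbits but takes both signs, so a function of
  three entries needs a computation of its own. For peaks the weighted sum splits, at fixed
  \<open>b\<close>, into alternating sums of lengths \<open>b + 1\<close> and \<open>b\<close>, one
  of which is even. For descents of distance \<open>2\<close> it comes down to an explicit count.
  Valleys, double ascents and double descents follow linearly from peaks and descents.

  Most other statistics are cut up by the leftmost position \<open>i\<close> involved. Only later
  positions then remain to be counted, and the code entries at \<open>i\<close> and
  \<open>i + 1\<close> tell how many later values lie below \<open>\<sigma> i\<close> and below
  \<open>\<sigma> (i + 1)\<close>. The order of these two neighbours is visible as well: the code
  drops strictly exactly at a descent. This is why adjacency in a vincular pattern matters, and why
  classical patterns occur only in pairs that leave the order of the last two letters free.\<close>

lemma sum_periodic_shift: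
  fixes h :: "nat \<Rightarrow> 'a::ab_group_add"
  assumes "\<And>t. h (t + N) = h t"
  shows "(\<Sum>t<N. h (t + s)) = (\<Sum>t<N. h t)"
proof (induction s)
  case (Suc s)
  have "(\<Sum>t<N. h (t + Suc s)) + h s = (\<Sum>t<Suc N. h (t + s))"
    by (simp add: sum.lessThan_Suc_shift del: sum.lessThan_Suc)
  also have "\<dots> = (\<Sum>t<N. h (t + s)) + h s"
    using assms[of s] by (simp add: add.commute)
  finally show ?case
    using Suc.IH by simp
qed simp

lemma sum_mod_shift:
  fixes h :: "nat \<Rightarrow> 'a::ab_group_add"
  shows "(\<Sum>a<m. h ((a + t) mod m)) = (\<Sum>a<m. h a)"
proof -
  have "(\<Sum>a<m. h ((a + t) mod m)) = (\<Sum>a<m. h (a mod m))"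
    by (rule sum_periodic_shift[where h = "\<lambda>x. h (x mod m)"]) simp
  then show ?thesis
    by simp
qed

text \<open>
  Summing the hypothesis over the points of an orbit \<open>O\<close> and exchanging the two sums gives
  \<open>card O * C = N * (\<Sum>y\<in>O. f y)\<close>; no information on the orbit length is needed.
\<close>

lemma homomesic_if_funpow_sum_const:
  assumes fin: "finite S" and bij: "bij_betw X S S" and N: "N > 0"
    and const: "\<And>x. x \<in> S \<Longrightarrow> (\<Sum>t<N. f ((X ^^ t) x)) = C"
  shows "homomesic S X f"
  unfolding homomesic_def c_mesic_def
proof (intro exI[of _ "real_of_int C / real N"] conjI ballI fin bij)
  fix x assume x: "x \<in> S"
  let ?O = "orbit X x"
  have sub: "?O \<subseteq> S"
  proof
    fix y assume "y \<in> ?O"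
    then show "y \<in> S"
      by (induction rule: orbit.induct) (use x bij in \<open>auto simp: bij_betw_def\<close>)
  qed
  have finO: "finite ?O"
    using sub fin finite_subset by blast
  have neO: "?O \<noteq> {}"
    by (rule orbit_nonempty)
  \<comment> \<open>An injective map of the finite orbit into itself permutes it, so every power of
    \<open>X\<close> merely reindexes the orbit sum.\<close>
  have step: "bij_betw X ?O ?O"
  proof -
    have "inj_on X ?O"
      using bij sub by (auto simp: bij_betw_def intro: inj_on_subset)
    moreover have "X ` ?O \<subseteq> ?O"
      by (auto intro: orbit.intros)
    ultimately show ?thesis
      using endo_inj_surj[OF finO] by (auto simp: bij_betw_def)
  qed
  have pow: "bij_betw (X ^^ t) ?O ?O" for t
    by (rule bij_betw_funpow[OF step])
  have "(\<Sum>y\<in>?O. C) = (\<Sum>y\<in>?O. \<Sum>t<N. f ((X ^^ t) y))"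
    using sub const by (intro sum.cong) auto
  also have "\<dots> = (\<Sum>t<N. \<Sum>y\<in>?O. f ((X ^^ t) y))"
    by (rule sum.swap)
  also have "\<dots> = (\<Sum>t<N. \<Sum>y\<in>?O. f y)"
    by (intro sum.cong refl sum.reindex_bij_betw pow)
  finally have "int (card ?O) * C = int N * (\<Sum>y\<in>?O. f y)"
    by simp
  then have "real (card ?O) * real_of_int C = real N * (\<Sum>y\<in>?O. real_of_int (f y))"
    by (metis of_int_mult of_int_of_nat_eq of_int_sum)
  then show "(\<Sum>y\<in>?O. real_of_int (f y)) / real (card ?O) = real_of_int C / real N"
    using N finO neO by (simp add: field_simps)
qed

section \<open>The Lehmer code\<close>

lemma finite_Sym: "finite (Sym n)"
  unfolding Sym_def by (simp add: finite_permutations)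

lemma Sym_eq_iff:
  assumes "\<sigma> \<in> Sym n"
  shows "\<sigma> i = \<sigma> j \<longleftrightarrow> i = j"
  using assms by (auto simp: Sym_def dest: permutes_inj injD)

lemma Sym_inj_on: "\<sigma> \<in> Sym n \<Longrightarrow> inj_on \<sigma> A"
  by (auto simp: inj_on_def Sym_eq_iff)

lemma Sym_in_iff: "\<sigma> \<in> Sym n \<Longrightarrow> \<sigma> i \<in> {1..n} \<longleftrightarrow> i \<in> {1..n}"
  unfolding Sym_def by (metis mem_Collect_eq permutes_in_image)

lemma Sym_image: "\<sigma> \<in> Sym n \<Longrightarrow> \<sigma> ` {1..n} = {1..n}"
  unfolding Sym_def by (simp add: permutes_image)

lemma lehmer_code_le: "lehmer_code n \<sigma> i \<le> n - i"
proof -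
  have "lehmer_code n \<sigma> i \<le> card {i<..n}"
    unfolding lehmer_code_def by (intro card_mono) auto
  then show ?thesis by simp
qed

lemma lehmer_code_values:
  assumes "\<sigma> \<in> Sym n" "1 \<le> i"
  shows "lehmer_code n \<sigma> i = card {v \<in> {1..n} - \<sigma> ` {1..<i}. v < \<sigma> i}"
proof -
  have "\<sigma> ` {j \<in> {i<..n}. \<sigma> j < \<sigma> i} = {v \<in> {1..n} - \<sigma> ` {1..<i}. v < \<sigma> i}" (is "?L = ?R")
  proof
    show "?L \<subseteq> ?R"
      using assms Sym_in_iff[OF assms(1)] by (force simp: Sym_eq_iff)
    show "?R \<subseteq> ?L"
    proof
      fix v assume v: "v \<in> ?R"
      then have "v \<in> \<sigma> ` {1..n}"
        using Sym_image[OF assms(1)] by blast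
      then obtain j where j: "j \<in> {1..n}" "v = \<sigma> j"
        by blast
      have "\<not> j < i"
        using v j by auto
      moreover have "j \<noteq> i"
        using v j by auto
      ultimately show "v \<in> ?L"
        using v j by auto
    qed
  qed
  then show ?thesis
    unfolding lehmer_code_def
    using card_image[OF Sym_inj_on[OF assms(1)], of "{j \<in> {i<..n}. \<sigma> j < \<sigma> i}"] by simp
qed

text \<open>A common prefix leaves the same set \<open>V\<close> of available values to both
  permutations; the code entry is the rank of the chosen value in \<open>V\<close>, and rank is
  strictly increasing.\<close>

lemma lehmer_code_less_iff:
  assumes "\<sigma> \<in> Sym n" "\<tau> \<in> Sym n" "i \<in> {1..n}" "\<And>j. j \<in> {1..<i} \<Longrightarrow> \<sigma> j = \<tau> j"
  shows "lehmer_code n \<sigma> i < lehmer_code n \<tau> i \<longleftrightarrow> \<sigma> i < \<tau> i"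
proof -
  define V where "V = {1..n} - \<sigma> ` {1..<i}"
  have img: "\<sigma> ` {1..<i} = \<tau> ` {1..<i}"
    using assms(4) by (intro image_cong) auto
  have c: "lehmer_code n \<sigma> i = card {v \<in> V. v < \<sigma> i}" "lehmer_code n \<tau> i = card {v \<in> V. v < \<tau> i}"
    using lehmer_code_values[OF assms(1)] lehmer_code_values[OF assms(2)] assms(3) img
    by (auto simp: V_def)
  have "\<sigma> i \<notin> \<sigma> ` {1..<i}" "\<tau> i \<notin> \<tau> ` {1..<i}"
    using Sym_eq_iff[OF assms(1)] Sym_eq_iff[OF assms(2)] by auto
  then have V: "\<sigma> i \<in> V" "\<tau> i \<in> V"
    using assms(3) Sym_in_iff[OF assms(1), of i] Sym_in_iff[OF assms(2), of i] img
    unfolding V_def by blast+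
  have mono: "card {v \<in> V. v < x} < card {v \<in> V. v < y}" if "x < y" "x \<in> V" for x y
    by (intro psubset_card_mono) (use that in \<open>auto simp: V_def\<close>)
  show ?thesis
    using mono[of "\<sigma> i" "\<tau> i"] mono[of "\<tau> i" "\<sigma> i"] V c by (metis less_asym linorder_neqE_nat)
qed

text \<open>Induction on the prefix: once the earlier values agree, neither code entry is smaller
  exactly when neither value is. With \<open>i = n + 1\<close> this gives injectivity of the code,
  and for smaller \<open>i\<close> it serves the lexicographic rank.\<close>

lemma lehmer_code_prefix_eq_iff:
  assumes "\<sigma> \<in> Sym n" "\<tau> \<in> Sym n" "i \<le> n + 1"
  shows "(\<forall>j\<in>{1..<i}. lehmer_code n \<sigma> j = lehmer_code n \<tau> j) \<longleftrightarrow> (\<forall>j\<in>{1..<i}. \<sigma> j = \<tau> j)"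
  using assms(3)
proof (induction i)
  case (Suc i)
  show ?case
  proof (cases "i = 0")
    case False
    have split: "{1..<Suc i} = insert i {1..<i}"
      using False by auto
    have "lehmer_code n \<sigma> i = lehmer_code n \<tau> i \<longleftrightarrow> \<sigma> i = \<tau> i"
      if "\<forall>j\<in>{1..<i}. \<sigma> j = \<tau> j"
      using lehmer_code_less_iff[OF assms(1,2), of i] lehmer_code_less_iff[OF assms(2,1), of i]
        that Suc.prems False
      by (metis Suc_le_mono add.commute atLeastAtMost_iff less_irrefl linorder_neqE_nat
          not_less_eq_eq plus_1_eq_Suc less_one linorder_not_less)
    then show ?thesis
      unfolding split using Suc.IH Suc.prems by auto
  qed simp
qed simp

text \<open>Extensional functions, so that a code is determined by its entries on
  \<open>{1..n}\<close> and the codes can be counted by \<open>card_PiE\<close>.\<close>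

definition codes :: "nat \<Rightarrow> (nat \<Rightarrow> nat) set" where
  "codes n = (\<Pi>\<^sub>E i\<in>{1..n}. {..n - i})"

text \<open>Only injectivity is proved directly. Both sides have \<open>n!\<close> elements, the
  product of the ranges \<open>n - i + 1\<close> being \<open>n!\<close> read backwards, so the
  injection is onto.\<close>

lemma bij_betw_lehmer_code:
  "bij_betw (\<lambda>\<sigma>. restrict (lehmer_code n \<sigma>) {1..n}) (Sym n) (codes n)" (is "bij_betw ?\<Phi> _ _")
proof -
  have inj: "inj_on ?\<Phi> (Sym n)"
  proof (rule inj_onI)
    fix \<sigma> \<tau> assume st: "\<sigma> \<in> Sym n" "\<tau> \<in> Sym n" "?\<Phi> \<sigma> = ?\<Phi> \<tau>"
    then have "\<forall>j\<in>{1..<n + 1}. lehmer_code n \<sigma> j = lehmer_code n \<tau> j"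
      by (metis atLeastLessThanSuc_atLeastAtMost restrict_apply' Suc_eq_plus1)
    then have "\<forall>j\<in>{1..<n + 1}. \<sigma> j = \<tau> j"
      using lehmer_code_prefix_eq_iff[OF st(1,2), of "n + 1"] by simp
    moreover have "\<sigma> j = \<tau> j" if "j \<notin> {1..n}" for j
      using st that unfolding Sym_def by (simp add: permutes_not_in)
    ultimately show "\<sigma> = \<tau>"
      by (intro ext) (metis atLeastLessThanSuc_atLeastAtMost Suc_eq_plus1)
  qed
  have sub: "?\<Phi> ` Sym n \<subseteq> codes n"
    by (auto simp: codes_def lehmer_code_le)
  have "card (codes n) = (\<Prod>i=1..n. Suc (n - i))"
    by (simp add: codes_def card_PiE)
  also have "\<dots> = (\<Prod>i=1..n. i)"
    by (rule prod.reindex_bij_witness[of _ "\<lambda>i. Suc (n - i)" "\<lambda>i. Suc (n - i)"]) auto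
  also have "\<dots> = card (Sym n)"
    unfolding Sym_def by (simp add: card_permutations fact_prod)
  finally have "card (codes n) = card (?\<Phi> ` Sym n)"
    by (simp only: card_image[OF inj])
  then have "?\<Phi> ` Sym n = codes n"
    using sub by (intro card_subset_eq) (auto simp: codes_def intro!: finite_PiE)
  with inj show ?thesis
    by (simp add: bij_betw_def)
qed

text \<open>This makes the \<open>THE\<close> in \<open>lehmer_rotation\<close> well defined, and
  its uniqueness part recovers a permutation from its code.\<close>

lemma ex1_lehmer_code:
  assumes "\<And>i. i \<in> {1..n} \<Longrightarrow> c i \<le> n - i"
  shows "\<exists>!\<tau>. \<tau> \<in> Sym n \<and> (\<forall>i\<in>{1..n}. lehmer_code n \<tau> i = c i)"
proof -
  have "restrict c {1..n} \<in> codes n"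
    using assms by (auto simp: codes_def)
  then have "\<exists>!\<tau>. \<tau> \<in> Sym n \<and> restrict (lehmer_code n \<tau>) {1..n} = restrict c {1..n}"
    using bij_betw_lehmer_code[of n] unfolding bij_betw_def inj_on_def by (metis (no_types, lifting) image_iff)
  moreover have "restrict (lehmer_code n \<tau>) {1..n} = restrict c {1..n} \<longleftrightarrow>
      (\<forall>i\<in>{1..n}. lehmer_code n \<tau> i = c i)" for \<tau>
    by (metis restrict_apply' restrict_ext)
  ultimately show ?thesis
    by simp
qed

lemma lehmer_rotation_props:
  "lehmer_rotation n \<sigma> \<in> Sym n \<and>
   (\<forall>i\<in>{1..n}. lehmer_code n (lehmer_rotation n \<sigma>) i = (lehmer_code n \<sigma> i + 1) mod (n - i + 1))"
proof -
  have "(lehmer_code n \<sigma> i + 1) mod (n - i + 1) \<le> n - i" for i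
    using mod_less_divisor[of "n - i + 1" "lehmer_code n \<sigma> i + 1"] by linarith
  from theI'[OF ex1_lehmer_code[OF this]] show ?thesis
    unfolding lehmer_rotation_def .
qed

lemma funpow_lehmer_rotation_in_Sym:
  "\<sigma> \<in> Sym n \<Longrightarrow> (lehmer_rotation n ^^ t) \<sigma> \<in> Sym n"
  by (induction t) (auto simp: lehmer_rotation_props)

lemma lehmer_code_funpow_rotation:
  assumes "i \<in> {1..n}"
  shows "lehmer_code n ((lehmer_rotation n ^^ t) \<sigma>) i = (lehmer_code n \<sigma> i + t) mod (n - i + 1)"
proof (induction t)
  case 0
  show ?case
    using lehmer_code_le[of n \<sigma> i] by simp
next
  case (Suc t)
  then show ?case
    using lehmer_rotation_props[of n "(lehmer_rotation n ^^ t) \<sigma>"] assms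
    by (simp add: mod_Suc_eq)
qed

text \<open>The added \<open>1\<close> cancels in each modulus, and congruent code entries are equal
  because both are already reduced; finiteness then gives surjectivity.\<close>

lemma bij_betw_lehmer_rotation: "bij_betw (lehmer_rotation n) (Sym n) (Sym n)"
proof -
  have "inj_on (lehmer_rotation n) (Sym n)"
  proof (rule inj_onI)
    fix \<sigma> \<tau> assume st: "\<sigma> \<in> Sym n" "\<tau> \<in> Sym n" "lehmer_rotation n \<sigma> = lehmer_rotation n \<tau>"
    have eq: "lehmer_code n \<sigma> i = lehmer_code n \<tau> i" if i: "i \<in> {1..n}" for i
    proof -
      have "[lehmer_code n \<sigma> i + 1 = lehmer_code n \<tau> i + 1] (mod (n - i + 1))"
        using lehmer_rotation_props[of n \<sigma>] lehmer_rotation_props[of n \<tau>] st(3) i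
        by (metis cong_def)
      then have "[lehmer_code n \<sigma> i = lehmer_code n \<tau> i] (mod (n - i + 1))"
        using cong_add_rcancel_nat by blast
      then show ?thesis
        using lehmer_code_le[of n \<sigma> i] lehmer_code_le[of n \<tau> i]
        by (simp add: cong_def)
    qed
    then show "\<sigma> = \<tau>"
      using ex1_lehmer_code[of n "lehmer_code n \<tau>"] st(1,2) by (metis lehmer_code_le)
  qed
  moreover have "lehmer_rotation n ` Sym n \<subseteq> Sym n"
    using lehmer_rotation_props by auto
  ultimately show ?thesis
    using endo_inj_surj[OF finite_Sym] by (auto simp: bij_betw_def)
qed

section \<open>Balanced statistics\<close>

text \<open>A single window length for all statistics: \<open>fact n\<close> is a multiple of every
  modulus. Integer linear combinations can then be formed without mentioning orbit lengths or
  quotients.\<close>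

definition balanced :: "nat \<Rightarrow> ((nat \<Rightarrow> nat) \<Rightarrow> int) \<Rightarrow> bool" where
  "balanced n f \<longleftrightarrow> (\<exists>C. \<forall>\<sigma>\<in>Sym n. (\<Sum>t<fact n. f ((lehmer_rotation n ^^ t) \<sigma>)) = C)"

lemma balanced_imp_homomesic:
  assumes "balanced n f"
  shows "homomesic (Sym n) (lehmer_rotation n) f"
  using assms homomesic_if_funpow_sum_const[OF finite_Sym bij_betw_lehmer_rotation, of "fact n"]
  unfolding balanced_def by (metis fact_gt_zero)

lemma balanced_cong:
  assumes "\<And>\<sigma>. \<sigma> \<in> Sym n \<Longrightarrow> f \<sigma> = g \<sigma>"
  shows "balanced n f \<longleftrightarrow> balanced n g"
proof -
  have "(\<Sum>t<fact n. f ((lehmer_rotation n ^^ t) \<sigma>)) = (\<Sum>t<fact n. g ((lehmer_rotation n ^^ t) \<sigma>))"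
    if "\<sigma> \<in> Sym n" for \<sigma>
    using that assms funpow_lehmer_rotation_in_Sym by (intro sum.cong) auto
  then show ?thesis
    unfolding balanced_def by auto
qed

lemma balanced_const: "balanced n (\<lambda>_. c)"
  by (simp add: balanced_def)

lemma balanced_add:
  assumes "balanced n f" "balanced n g"
  shows "balanced n (\<lambda>\<sigma>. f \<sigma> + g \<sigma>)"
  using assms unfolding balanced_def by (auto simp: sum.distrib)

lemma balanced_cmult:
  assumes "balanced n f"
  shows "balanced n (\<lambda>\<sigma>. c * f \<sigma>)"
  using assms unfolding balanced_def by (auto simp: sum_distrib_left[symmetric])

lemma balanced_diff:
  assumes "balanced n f" "balanced n g"
  shows "balanced n (\<lambda>\<sigma>. f \<sigma> - g \<sigma>)"
  using balanced_add[OF assms(1) balanced_cmult[OF assms(2), of "-1"]] by simp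

lemma balanced_sum:
  assumes "\<And>i. i \<in> A \<Longrightarrow> balanced n (\<lambda>\<sigma>. f i \<sigma>)"
  shows "balanced n (\<lambda>\<sigma>. \<Sum>i\<in>A. f i \<sigma>)"
  using assms
  by (induction A rule: infinite_finite_induct) (auto intro: balanced_const balanced_add)

text \<open>Every starting permutation sees the same periodic reference sequence \<open>h\<close>,
  only with its own delay \<open>s\<close>, and a sum over a full period ignores the delay.\<close>

lemma balanced_if_shift:
  assumes "\<And>t. h (t + fact n) = h t"
    and "\<And>\<sigma>. \<sigma> \<in> Sym n \<Longrightarrow> \<exists>s. \<forall>t. f ((lehmer_rotation n ^^ t) \<sigma>) = h (t + s)"
  shows "balanced n f"
  unfolding balanced_def
proof (intro exI ballI)
  fix \<sigma> assume "\<sigma> \<in> Sym n"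
  then obtain s where "\<forall>t. f ((lehmer_rotation n ^^ t) \<sigma>) = h (t + s)"
    using assms(2) by blast
  then show "(\<Sum>t<fact n. f ((lehmer_rotation n ^^ t) \<sigma>)) = (\<Sum>t<fact n. h t)"
    using sum_periodic_shift[of h "fact n", OF assms(1)] by simp
qed

section \<open>Rotating one, two or three consecutive code entries\<close>

lemma add_mod_of_dvd: "m dvd N \<Longrightarrow> (t + N) mod m = t mod (m::nat)"
  by (auto elim!: dvdE)

lemma modulus_dvd_fact: "1 \<le> i \<Longrightarrow> i \<le> n \<Longrightarrow> n - i + 1 dvd (fact n :: nat)"
  by (rule dvd_fact) auto

lemma cong_shift_mod: "[s = a] (mod m) \<Longrightarrow> (a + t) mod m = (t + s) mod (m::nat)"
  by (metis add.commute cong_def mod_add_left_eq)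

lemma balanced_code2:
  assumes "1 \<le> i" "i < n"
    and f: "\<And>\<sigma>. \<sigma> \<in> Sym n \<Longrightarrow> f \<sigma> = g (lehmer_code n \<sigma> i) (lehmer_code n \<sigma> (i + 1))"
  shows "balanced n f"
proof -
  define m where "m = n - i"
  have m: "n - i + 1 = Suc m" "n - (i + 1) + 1 = m"
    using assms by (auto simp: m_def)
  have dvd: "Suc m dvd fact n" "m dvd fact n"
    using modulus_dvd_fact[of i n] modulus_dvd_fact[of "i + 1" n] assms m by auto
  show ?thesis
  proof (rule balanced_if_shift[where h = "\<lambda>t. g (t mod Suc m) (t mod m)"])
    show "g ((t + fact n) mod Suc m) ((t + fact n) mod m) = g (t mod Suc m) (t mod m)" for t
      using dvd by (simp add: add_mod_of_dvd)
    fix \<sigma> assume \<sigma>: "\<sigma> \<in> Sym n"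
    \<comment> \<open>\<open>s\<close> is a time at which the pair of entries started at
      \<open>(0, 0)\<close> shows the two entries of \<open>\<sigma>\<close>.\<close>
    obtain s where s: "[s = lehmer_code n \<sigma> i] (mod (Suc m))" "[s = lehmer_code n \<sigma> (i + 1)] (mod m)"
      using binary_chinese_remainder_nat[of "Suc m" m] by auto
    have "f ((lehmer_rotation n ^^ t) \<sigma>) = g ((t + s) mod Suc m) ((t + s) mod m)" for t
      using assms \<sigma> m s cong_shift_mod
      by (subst f) (auto simp: funpow_lehmer_rotation_in_Sym lehmer_code_funpow_rotation simp del: add_Suc_right)
    then show "\<exists>s. \<forall>t. f ((lehmer_rotation n ^^ t) \<sigma>) = g ((t + s) mod Suc m) ((t + s) mod m)"
      by blast
  qed
qed

lemma balanced_code1: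
  assumes "1 \<le> i" "i \<le> n"
    and f: "\<And>\<sigma>. \<sigma> \<in> Sym n \<Longrightarrow> f \<sigma> = g (lehmer_code n \<sigma> i)"
  shows "balanced n f"
proof (rule balanced_if_shift[where h = "\<lambda>t. g (t mod (n - i + 1))"])
  show "g ((t + fact n) mod (n - i + 1)) = g (t mod (n - i + 1))" for t
    using modulus_dvd_fact[OF assms(1,2)] by (metis add_mod_of_dvd)
  fix \<sigma> assume \<sigma>: "\<sigma> \<in> Sym n"
  have "f ((lehmer_rotation n ^^ t) \<sigma>) = g ((t + lehmer_code n \<sigma> i) mod (n - i + 1))" for t
    using assms \<sigma>
    by (subst f) (auto simp: funpow_lehmer_rotation_in_Sym lehmer_code_funpow_rotation add.commute)
  then show "\<exists>s. \<forall>t. f ((lehmer_rotation n ^^ t) \<sigma>) = g ((t + s) mod (n - i + 1))"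
    by blast
qed

text \<open>The middle modulus is coprime to both neighbours, so \<open>b\<close> can be met last.
  The outer moduli differ by \<open>2\<close>; they are coprime for odd \<open>m\<close> and have
  greatest common divisor \<open>2\<close> for even \<open>m\<close>.\<close>

lemma chinese_remainder_three_consecutive:
  fixes m a b c :: nat
  assumes par: "even m \<Longrightarrow> even (a + c)"
  shows "\<exists>s. [s = a] (mod (m + 2)) \<and> [s = b] (mod (m + 1)) \<and> [s = c] (mod m)"
proof -
  obtain s0 where s0: "[s0 = a] (mod (m + 2))" "[s0 = c] (mod m)"
  proof (cases "even m")
    case True
    \<comment> \<open>The candidate is \<open>c + m * k\<close>, which is right modulo
      \<open>m\<close>. Modulo \<open>m + 2\<close>, where \<open>m\<close> is \<open>-2\<close>, it
      equals \<open>c - 2 * k\<close>, so \<open>2 * k\<close> has to be \<open>c - a\<close>;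
      \<open>(m + 1) * a\<close> is \<open>- a\<close> without leaving the naturals, and parity
      makes the division exact.\<close>
    define k where "k = (c + (m + 1) * a) div 2"
    have k: "2 * k = c + (m + 1) * a"
      using True par[OF True] by (auto simp: k_def)
    have "c + m * k + (m + 2) * a = a + (m + 2) * k"
      using k by (simp add: algebra_simps)
    then have "[c + m * k = a] (mod (m + 2))"
      by (metis cong_def mod_mult_self2)
    moreover have "[c + m * k = c] (mod m)"
      by (simp add: cong_def)
    ultimately show ?thesis
      using that by blast
  next
    case False
    then have "coprime (m + 2) m"
      by (metis add.commute coprime_add_one_right coprime_commute coprime_left_2_iff_odd
          gcd_add1 coprime_iff_gcd_eq_1)
    then show ?thesis
      using that binary_chinese_remainder_nat by blast
  qed
  have "coprime ((m + 2) * m) (m + 1)"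
    by (metis add.assoc add_2_eq_Suc' coprime_Suc_left_nat coprime_Suc_right_nat coprime_mult_left_iff
        Suc_eq_plus1 add_Suc_right nat_1_add_1)
  then obtain s where s: "[s = s0] (mod ((m + 2) * m))" "[s = b] (mod (m + 1))"
    using binary_chinese_remainder_nat by blast
  have "[s = s0] (mod (m + 2))" "[s = s0] (mod m)"
    using s(1) cong_modulus_mult_nat by (blast, metis mult.commute cong_modulus_mult_nat)
  then show ?thesis
    using s s0 cong_trans by blast
qed

lemma sum_alternating: "(\<Sum>a<k. (-1 :: int) ^ a) = of_bool (odd k)"
  by (induction k) (auto simp: minus_one_power_iff)

text \<open>
  For three consecutive entries the outer moduli \<open>m + 2\<close> and \<open>m\<close> share the factor \<open>2\<close> when
  \<open>m\<close> is even, and the parity of \<open>a + c\<close> is the only invariant of the joint rotation. The sums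
  over the two parity classes agree when the sum weighted by \<open>(-1) ^ (a + c)\<close> vanishes.
\<close>

lemma rotated_triple_sum_const:
  fixes g :: "nat \<Rightarrow> nat \<Rightarrow> nat \<Rightarrow> int"
  assumes m: "m > 0" and dvd: "m + 2 dvd N" "m + 1 dvd N" "m dvd N"
    and alt: "even m \<Longrightarrow> (\<Sum>a<m + 2. \<Sum>b<m + 1. \<Sum>c<m. (-1) ^ (a + c) * g a b c) = 0"
  shows "(\<Sum>t<N. g ((a + t) mod (m + 2)) ((b + t) mod (m + 1)) ((c + t) mod m)) =
         (\<Sum>t<N. g (t mod (m + 2)) (t mod (m + 1)) (t mod m))"
proof -
  define S where "S = (\<lambda>a b c. \<Sum>t<N. g ((a + t) mod (m + 2)) ((b + t) mod (m + 1)) ((c + t) mod m))"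
  \<comment> \<open>\<open>(d a c, 0, 0)\<close> represents the class of \<open>(a, b, c)\<close>: a
    single class for odd \<open>m\<close>, one for each parity of \<open>a + c\<close> for even
    \<open>m\<close>.\<close>
  define d where "d = (\<lambda>a c :: nat. if even m \<and> odd (a + c) then 1 else 0 :: nat)"
  have S: "S a b c = S (d a c) 0 0" for a b c
  proof -
    define h where "h = (\<lambda>t. g ((d a c + t) mod (m + 2)) (t mod (m + 1)) (t mod m))"
    \<comment> \<open>The delay \<open>s\<close> from \<open>(d a c, 0, 0)\<close> to
      \<open>(a, b, c)\<close> must be \<open>a - d a c\<close> modulo \<open>m + 2\<close>. Since
      \<open>m + 1\<close> is \<open>-1\<close> there, this is written
      \<open>a + d a c * (m + 1)\<close>.\<close>
    have "even m \<Longrightarrow> even (a + d a c * (m + 1) + c)"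
      by (auto simp: d_def)
    then obtain s where s: "[s = a + d a c * (m + 1)] (mod (m + 2))" "[s = b] (mod (m + 1))"
        "[s = c] (mod m)"
      using chinese_remainder_three_consecutive by blast
    have "[s + d a c = a + d a c * (m + 1) + d a c] (mod (m + 2))"
      using s(1) by (simp add: cong_add_rcancel_nat)
    moreover have "a + d a c * (m + 1) + d a c = a + d a c * (m + 2)"
      by (simp add: algebra_simps)
    ultimately have "[s + d a c = a] (mod (m + 2))"
      by (metis cong_def mod_mult_self1)
    then have s': "(a + t) mod (m + 2) = (d a c + (t + s)) mod (m + 2)" for t
      using cong_shift_mod[of "s + d a c" a "m + 2" t] by (simp only: ac_simps)
    have "S a b c = (\<Sum>t<N. h (t + s))"
      unfolding S_def h_def using s cong_shift_mod s' by simp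
    also have "\<dots> = (\<Sum>t<N. h t)"
    proof (rule sum_periodic_shift)
      show "h (t + N) = h t" for t
        unfolding h_def using dvd by (simp add: add_mod_of_dvd add.assoc[symmetric])
    qed
    finally show ?thesis
      by (simp add: S_def h_def)
  qed
  have "S (d a c) 0 0 = S 0 0 0" for a c
  proof (cases "even m")
    case ev: True
    let ?A = "{..<m + 2}" and ?B = "{..<m + 1}" and ?C = "{..<m}"
    have sgn: "(-1 :: int) ^ ((x + t) mod M) = (-1) ^ x * (-1) ^ t" if "even M" for x t M :: nat
    proof -
      have "even ((x + t) mod M) \<longleftrightarrow> even (x + t)"
        using that by (simp add: dvd_mod_iff)
      then show ?thesis
        by (simp add: minus_one_power_iff)
    qed
    have "(\<Sum>a\<in>?A. \<Sum>b\<in>?B. \<Sum>c\<in>?C. (-1) ^ (a + c) * S a b c) =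
        (\<Sum>a\<in>?A. \<Sum>b\<in>?B. \<Sum>c\<in>?C. \<Sum>t<N.
          (-1) ^ (a + c) * g ((a + t) mod (m + 2)) ((b + t) mod (m + 1)) ((c + t) mod m))"
      by (simp add: S_def sum_distrib_left)
    also have "\<dots> = (\<Sum>t<N. \<Sum>a\<in>?A. \<Sum>b\<in>?B. \<Sum>c\<in>?C.
          (-1) ^ (a + c) * g ((a + t) mod (m + 2)) ((b + t) mod (m + 1)) ((c + t) mod m))"
      by (simp only: sum.swap[where A = ?C and B = "{..<N}"] sum.swap[where A = ?B and B = "{..<N}"]
          sum.swap[where A = ?A and B = "{..<N}"])
    \<comment> \<open>Reduction modulo an even number keeps parity, so rotating \<open>a\<close> and
      \<open>c\<close> by \<open>t\<close> changes the sign by \<open>(-1) ^ t\<close> twice. The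
      weight can therefore be rotated along with \<open>g\<close>, and each \<open>t\<close>
      contributes the same sum over all triples.\<close>
    also have "\<dots> = (\<Sum>t<N. \<Sum>a\<in>?A. \<Sum>b\<in>?B. \<Sum>c\<in>?C.
          (-1) ^ ((a + t) mod (m + 2) + (c + t) mod m) *
          g ((a + t) mod (m + 2)) ((b + t) mod (m + 1)) ((c + t) mod m))"
      using ev by (intro sum.cong refl) (simp add: power_add sgn)
    also have "\<dots> = (\<Sum>t<N. \<Sum>a\<in>?A. \<Sum>b\<in>?B. \<Sum>c\<in>?C. (-1) ^ (a + c) * g a b c)"
    proof (rule sum.cong[OF refl])
      fix t
      define G where "G = (\<lambda>a b c. (-1) ^ (a + c) * g a b c)"
      have "(\<Sum>a\<in>?A. \<Sum>b\<in>?B. \<Sum>c\<in>?C. G ((a + t) mod (m + 2)) ((b + t) mod (m + 1)) ((c + t) mod m))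
         = (\<Sum>a\<in>?A. \<Sum>b\<in>?B. \<Sum>c\<in>?C. G a b c)"
        by (simp only: sum_mod_shift sum_mod_shift[where h = "\<lambda>b. \<Sum>c\<in>?C. G _ b c"]
            sum_mod_shift[where h = "\<lambda>a. \<Sum>b\<in>?B. \<Sum>c\<in>?C. G a b c"])
      then show "(\<Sum>a\<in>?A. \<Sum>b\<in>?B. \<Sum>c\<in>?C. (-1) ^ ((a + t) mod (m + 2) + (c + t) mod m) *
            g ((a + t) mod (m + 2)) ((b + t) mod (m + 1)) ((c + t) mod m)) =
          (\<Sum>a\<in>?A. \<Sum>b\<in>?B. \<Sum>c\<in>?C. (-1) ^ (a + c) * g a b c)"
        by (simp add: G_def)
    qed
    also have "\<dots> = 0"
      using alt[OF ev] by simp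
    finally have zero: "(\<Sum>a\<in>?A. \<Sum>b\<in>?B. \<Sum>c\<in>?C. (-1) ^ (a + c) * S a b c) = 0" .
    \<comment> \<open>\<open>S\<close> takes only the values \<open>S 0 0 0\<close> and
      \<open>S 1 0 0\<close>, according to the parity of \<open>a + c\<close>. Twice the weighted
      value is \<open>X\<close> times the sign plus the difference \<open>D\<close>. The sign sums
      to zero over the even range of \<open>c\<close>, so what is left of the vanishing sum is
      \<open>D\<close> times the number of triples.\<close>
    define X where "X = S 0 0 0 + S 1 0 0"
    define D where "D = S 0 0 0 - S 1 0 0"
    have summand: "2 * ((-1) ^ (a + c) * S a b c) = X * ((-1) ^ a * (-1) ^ c) + D" for a b c
      by (subst S) (auto simp: X_def D_def d_def ev minus_one_power_iff)
    have alt0: "(\<Sum>a\<in>?C. (-1 :: int) ^ a) = 0"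
      using ev by (simp add: sum_alternating)
    have "0 = (\<Sum>a\<in>?A. \<Sum>b\<in>?B. \<Sum>c\<in>?C. 2 * ((-1) ^ (a + c) * S a b c))"
      by (simp only: sum_distrib_left[symmetric] zero mult_zero_right)
    also have "\<dots> = (\<Sum>a\<in>?A. \<Sum>b\<in>?B. X * ((-1) ^ a * (\<Sum>c\<in>?C. (-1) ^ c)) + int m * D)"
      unfolding summand by (simp add: sum.distrib sum_distrib_left)
    also have "\<dots> = int (m + 2) * (int (m + 1) * (int m * D))"
      unfolding alt0 by simp
    finally have "D = 0"
      using m by simp
    then show ?thesis
      by (auto simp: D_def d_def)
  qed (simp add: d_def)
  then show ?thesis
    using S[of a b c] by (simp add: S_def)
qed

lemma balanced_code3:
  assumes "1 \<le> i" "i + 2 \<le> n"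
    and f: "\<And>\<sigma>. \<sigma> \<in> Sym n \<Longrightarrow>
      f \<sigma> = g (lehmer_code n \<sigma> i) (lehmer_code n \<sigma> (i + 1)) (lehmer_code n \<sigma> (i + 2))"
    and alt: "\<And>m. m = n - i - 1 \<Longrightarrow> even m \<Longrightarrow>
      (\<Sum>a<m + 2. \<Sum>b<m + 1. \<Sum>c<m. (-1) ^ (a + c) * g a b c) = 0"
  shows "balanced n f"
  unfolding balanced_def
proof (intro exI ballI)
  fix \<sigma> assume \<sigma>: "\<sigma> \<in> Sym n"
  define m where "m = n - i - 1"
  have m: "n - i + 1 = m + 2" "n - (i + 1) + 1 = m + 1" "n - (i + 2) + 1 = m" "m > 0"
    using assms(1,2) by (auto simp: m_def)
  have dvd: "m + 2 dvd fact n" "m + 1 dvd fact n" "m dvd fact n"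
    using modulus_dvd_fact[of i n] modulus_dvd_fact[of "i + 1" n] modulus_dvd_fact[of "i + 2" n]
      assms(1,2) m by auto
  have "f ((lehmer_rotation n ^^ t) \<sigma>) = g ((lehmer_code n \<sigma> i + t) mod (m + 2))
      ((lehmer_code n \<sigma> (i + 1) + t) mod (m + 1)) ((lehmer_code n \<sigma> (i + 2) + t) mod m)" for t
    using f[OF funpow_lehmer_rotation_in_Sym[OF \<sigma>]] assms(1,2)
      lehmer_code_funpow_rotation[of i n t \<sigma>] lehmer_code_funpow_rotation[of "i + 1" n t \<sigma>]
      lehmer_code_funpow_rotation[of "i + 2" n t \<sigma>] m by auto
  then show "(\<Sum>t<fact n. f ((lehmer_rotation n ^^ t) \<sigma>)) =
      (\<Sum>t<fact n. g (t mod (m + 2)) (t mod (m + 1)) (t mod m))"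
    using rotated_triple_sum_const[OF m(4) dvd alt] m_def by simp
qed

section \<open>Reading statistics off the Lehmer code\<close>

lemma card_filter_eq_sum: "finite A \<Longrightarrow> int (card {i \<in> A. P i}) = (\<Sum>i\<in>A. of_bool (P i))"
  by (simp add: Collect_conj_eq)

lemma balanced_if_sum:
  assumes "\<And>\<sigma>. \<sigma> \<in> Sym n \<Longrightarrow> f \<sigma> = (\<Sum>i\<in>A. h i \<sigma>)" "\<And>i. i \<in> A \<Longrightarrow> balanced n (h i)"
  shows "balanced n f"
  using balanced_cong[of n f "\<lambda>\<sigma>. \<Sum>i\<in>A. h i \<sigma>"] balanced_sum[of A n h] assms by blast

lemma Sym_less_or_less: "\<sigma> \<in> Sym n \<Longrightarrow> i \<noteq> j \<Longrightarrow> \<not> \<sigma> i < \<sigma> j \<longleftrightarrow> \<sigma> j < \<sigma> i"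
  using Sym_eq_iff[of \<sigma> n i j] by linarith

lemma card_later_greater:
  assumes "\<sigma> \<in> Sym n"
  shows "card {j \<in> {i<..n}. \<sigma> i < \<sigma> j} = n - i - lehmer_code n \<sigma> i"
proof -
  have eq: "{j \<in> {i<..n}. \<sigma> i < \<sigma> j} = {i<..n} - {j \<in> {i<..n}. \<sigma> j < \<sigma> i}"
    using Sym_less_or_less[OF assms] by fastforce
  show ?thesis
    unfolding eq lehmer_code_def by (subst card_Diff_subset) auto
qed

text \<open>With position \<open>i + 1\<close> split off, the remaining count runs over the same
  positions as the next code entry, which makes the two comparable.\<close>

lemma lehmer_code_step:
  assumes "i < n"
  shows "lehmer_code n \<sigma> i = card {j \<in> {i + 1<..n}. \<sigma> j < \<sigma> i} + of_bool (\<sigma> (i + 1) < \<sigma> i)"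
proof -
  have "{j \<in> {i<..n}. \<sigma> j < \<sigma> i} =
      {j \<in> {i + 1<..n}. \<sigma> j < \<sigma> i} \<union> (if \<sigma> (i + 1) < \<sigma> i then {i + 1} else {})"
  proof -
    have "{i<..n} = insert (i + 1) {i + 1<..n}"
      using assms by auto
    then show ?thesis
      by auto
  qed
  moreover have "card \<dots> = card {j \<in> {i + 1<..n}. \<sigma> j < \<sigma> i} + of_bool (\<sigma> (i + 1) < \<sigma> i)"
    by (auto simp: card_insert_if)
  ultimately show ?thesis
    by (simp add: lehmer_code_def)
qed

text \<open>Beyond position \<open>i + 1\<close>, the larger of the two values has at least as many
  smaller entries. At a descent the entry at \<open>i\<close> also counts position
  \<open>i + 1\<close>, which makes the inequality strict.\<close>

lemma descent_iff_lehmer_code: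
  assumes "\<sigma> \<in> Sym n" "i < n"
  shows "\<sigma> (i + 1) < \<sigma> i \<longleftrightarrow> lehmer_code n \<sigma> (i + 1) < lehmer_code n \<sigma> i"
proof (cases "\<sigma> (i + 1) < \<sigma> i")
  case True
  have "lehmer_code n \<sigma> (i + 1) \<le> card {j \<in> {i + 1<..n}. \<sigma> j < \<sigma> i}"
    unfolding lehmer_code_def by (intro card_mono) (use True in auto)
  then show ?thesis
    using lehmer_code_step[OF assms(2), of \<sigma>] True by simp
next
  case False
  then have "\<sigma> i < \<sigma> (i + 1)"
    using Sym_less_or_less[OF assms(1), of "i + 1" i] by simp
  then have "card {j \<in> {i + 1<..n}. \<sigma> j < \<sigma> i} \<le> lehmer_code n \<sigma> (i + 1)"
    unfolding lehmer_code_def by (intro card_mono) auto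
  then show ?thesis
    using lehmer_code_step[OF assms(2), of \<sigma>] False by simp
qed

lemma ascent_iff_lehmer_code:
  assumes "\<sigma> \<in> Sym n" "i < n"
  shows "\<sigma> i < \<sigma> (i + 1) \<longleftrightarrow> lehmer_code n \<sigma> i \<le> lehmer_code n \<sigma> (i + 1)"
  using descent_iff_lehmer_code[OF assms] Sym_less_or_less[OF assms(1), of i "i + 1"] by auto

text \<open>Deleting position \<open>i + 1\<close> makes \<open>i\<close> and \<open>i + 2\<close>
  adjacent and lowers the code at \<open>i\<close> by one if
  \<open>\<sigma> (i + 1) < \<sigma> i\<close>. The correction used here is instead the indicator of
  \<open>\<sigma> (i + 1) < \<sigma> (i + 2)\<close>, which the code shows directly. It is at most
  the true correction when \<open>\<sigma> (i + 2) < \<sigma> i\<close> and at least that otherwise,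
  so the verdict is unchanged.\<close>

lemma descent2_iff_lehmer_code:
  assumes \<sigma>: "\<sigma> \<in> Sym n" and i: "i + 2 \<le> n"
  shows "\<sigma> (i + 2) < \<sigma> i \<longleftrightarrow> lehmer_code n \<sigma> (i + 2) +
    of_bool (lehmer_code n \<sigma> (i + 1) \<le> lehmer_code n \<sigma> (i + 2)) < lehmer_code n \<sigma> i"
proof -
  define L where "L = {j \<in> {i + 2<..n}. \<sigma> j < \<sigma> i}"
  have split: "{j \<in> {i + 1<..n}. \<sigma> j < \<sigma> i} = L \<union> (if \<sigma> (i + 2) < \<sigma> i then {i + 2} else {})"
  proof -
    have "{i + 1<..n} = insert (i + 2) {i + 2<..n}"
      using i by auto
    then show ?thesis
      by (auto simp: L_def)
  qed
  have "card \<dots> = card L + of_bool (\<sigma> (i + 2) < \<sigma> i)"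
    by (auto simp: L_def card_insert_if)
  then have code: "lehmer_code n \<sigma> i =
      card L + of_bool (\<sigma> (i + 2) < \<sigma> i) + of_bool (\<sigma> (i + 1) < \<sigma> i)"
    using lehmer_code_step[of i n \<sigma>] i split by simp
  have asc: "\<sigma> (i + 1) < \<sigma> (i + 2) \<longleftrightarrow> lehmer_code n \<sigma> (i + 1) \<le> lehmer_code n \<sigma> (i + 2)"
    using ascent_iff_lehmer_code[OF \<sigma>, of "i + 1"] i by (simp add: numeral_2_eq_2)
  have ne: "\<sigma> (i + 1) \<noteq> \<sigma> (i + 2)" "\<sigma> i \<noteq> \<sigma> (i + 1)" "\<sigma> i \<noteq> \<sigma> (i + 2)"
    by (auto simp: Sym_eq_iff[OF \<sigma>])
  show ?thesis
  proof (cases "\<sigma> (i + 2) < \<sigma> i")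
    case True
    have "lehmer_code n \<sigma> (i + 2) \<le> card L"
      unfolding lehmer_code_def L_def by (intro card_mono) (use True in auto)
    then show ?thesis
      using True code asc ne by (auto simp: of_bool_def)
  next
    case False
    then have "card L \<le> lehmer_code n \<sigma> (i + 2)"
      unfolding lehmer_code_def L_def by (intro card_mono) auto
    then show ?thesis
      using False code asc ne by (auto simp: of_bool_def)
  qed
qed

lemma lehmer_code_first:
  assumes "\<sigma> \<in> Sym n" "1 \<le> n"
  shows "\<sigma> 1 = lehmer_code n \<sigma> 1 + 1"
proof -
  have "\<sigma> 1 \<in> {1..n}"
    using Sym_in_iff[OF assms(1), of 1] assms(2) by simp
  then have "{v \<in> {1..n} - \<sigma> ` {1..<1}. v < \<sigma> 1} = {1..<\<sigma> 1}"
    by auto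
  then show ?thesis
    using lehmer_code_values[OF assms(1), of 1] \<open>\<sigma> 1 \<in> {1..n}\<close> by simp
qed

section \<open>Descents, peaks and runs\<close>

lemma balanced_descent_at:
  assumes "1 \<le> i" "i < n"
  shows "balanced n (\<lambda>\<sigma>. of_bool (\<sigma> (i + 1) < \<sigma> i))"
  by (rule balanced_code2[OF assms, where g = "\<lambda>a b. of_bool (b < a)"])
     (simp only: descent_iff_lehmer_code[OF _ assms(2)])

text \<open>Arbitrary weights treat several statistics at once: \<open>i\<close> and
  \<open>n - i\<close> give the two major indices, and indicator weights give the number of
  descents, its parity versions and membership of a fixed index.\<close>

lemma balanced_descents_weighted:
  fixes w :: "nat \<Rightarrow> int"
  shows "balanced n (\<lambda>\<sigma>. \<Sum>i\<in>descents n \<sigma>. w i)"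
proof -
  have "(\<Sum>i\<in>descents n \<sigma>. w i) = (\<Sum>i\<in>{1..<n}. w i * of_bool (\<sigma> (i + 1) < \<sigma> i))" for \<sigma>
    unfolding descents_def by (simp add: sum.inter_filter[symmetric] if_distrib of_bool_def cong: if_cong)
  then show ?thesis
    by (rule balanced_if_sum) (intro balanced_cmult balanced_descent_at; simp)
qed

lemma finite_descents: "finite (descents n \<sigma>)"
  by (simp add: descents_def)

lemma balanced_descents_filter: "balanced n (\<lambda>\<sigma>. int (card {i \<in> descents n \<sigma>. P i}))"
  using balanced_descents_weighted[of n "\<lambda>i. of_bool (P i)"]
  by (simp only: card_filter_eq_sum[OF finite_descents])

lemma balanced_descents: "balanced n (\<lambda>\<sigma>. int (card (descents n \<sigma>)))"
  using balanced_descents_filter[of n "\<lambda>_. True"] by simp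

lemma balanced_major_index: "balanced n (\<lambda>\<sigma>. int (major_index n \<sigma>))"
  using balanced_descents_weighted[of n int] by (simp add: major_index_def)

lemma balanced_comajor_index: "balanced n (\<lambda>\<sigma>. int (comajor_index n \<sigma>))"
  using balanced_descents_weighted[of n "\<lambda>i. int (n - i)"] by (simp add: comajor_index_def)

lemma card_ascents: "int (card (ascents n \<sigma>)) = int (n - 1) - int (card (descents n \<sigma>))"
proof -
  have "descents n \<sigma> \<subseteq> {1..<n}"
    by (auto simp: descents_def)
  then have "card (descents n \<sigma>) \<le> card {1..<n}"
    by (intro card_mono) auto
  then show ?thesis
    unfolding ascents_def using \<open>descents n \<sigma> \<subseteq> {1..<n}\<close> finite_descents
    by (simp add: card_Diff_subset of_nat_diff)
qed

lemma balanced_ascents: "balanced n (\<lambda>\<sigma>. int (card (ascents n \<sigma>)))"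
  unfolding card_ascents by (intro balanced_diff balanced_const balanced_descents)

text \<open>In code entries a peak reads \<open>a \<le> b \<and> c < b\<close>, so for fixed
  \<open>b\<close> the conditions on \<open>a\<close> and \<open>c\<close> are independent and the
  weighted sum becomes a product.\<close>

lemma balanced_peak_at:
  assumes "1 \<le> i" "i + 2 \<le> n"
  shows "balanced n (\<lambda>\<sigma>. of_bool (\<sigma> i < \<sigma> (i + 1) \<and> \<sigma> (i + 2) < \<sigma> (i + 1)))"
proof (rule balanced_code3[OF assms, where g = "\<lambda>a b c. of_bool (a \<le> b \<and> c < b)"])
  fix \<sigma> assume \<sigma>: "\<sigma> \<in> Sym n"
  show "of_bool (\<sigma> i < \<sigma> (i + 1) \<and> \<sigma> (i + 2) < \<sigma> (i + 1)) =
    of_bool (lehmer_code n \<sigma> i \<le> lehmer_code n \<sigma> (i + 1) \<and>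
      lehmer_code n \<sigma> (i + 2) < lehmer_code n \<sigma> (i + 1))"
    using ascent_iff_lehmer_code[OF \<sigma>, of i] descent_iff_lehmer_code[OF \<sigma>, of "i + 1"] assms
    by (simp add: numeral_2_eq_2)
next
  fix m :: nat
  have "(\<Sum>a<m + 2. \<Sum>b<m + 1. \<Sum>c<m. (-1 :: int) ^ (a + c) * of_bool (a \<le> b \<and> c < b)) =
      (\<Sum>b<m + 1. \<Sum>a<m + 2. \<Sum>c<m. ((-1) ^ a * of_bool (a \<le> b)) * ((-1) ^ c * of_bool (c < b)))"
    by (subst sum.swap) (intro sum.cong refl, auto simp: power_add)
  also have "\<dots> = (\<Sum>b<m + 1. (\<Sum>a<m + 2. (-1) ^ a * of_bool (a \<le> b)) *
      (\<Sum>c<m. (-1) ^ c * of_bool (c < b)))"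
    by (simp only: sum_product)
  also have "\<dots> = 0"
  proof (rule sum.neutral, rule ballI)
    \<comment> \<open>Since \<open>b \<le> m\<close>, neither range cuts the conditions off:
      \<open>b + 1\<close> values of \<open>a\<close> and \<open>b\<close> values of
      \<open>c\<close> remain, and one of these lengths is even.\<close>
    fix b assume b: "b \<in> {..<m + 1}"
    have "(\<Sum>a<m + 2. (-1 :: int) ^ a * of_bool (a \<le> b)) = (\<Sum>a<b + 1. (-1) ^ a)"
      by (rule sum.mono_neutral_cong_right) (use b in auto)
    moreover have "(\<Sum>c<m. (-1 :: int) ^ c * of_bool (c < b)) = (\<Sum>c<b. (-1) ^ c)"
      by (rule sum.mono_neutral_cong_right) (use b in auto)
    ultimately show "(\<Sum>a<m + 2. (-1 :: int) ^ a * of_bool (a \<le> b)) *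
      (\<Sum>c<m. (-1) ^ c * of_bool (c < b)) = 0"
      unfolding sum_alternating by simp
  qed
  finally show "(\<Sum>a<m + 2. \<Sum>b<m + 1. \<Sum>c<m. (-1 :: int) ^ (a + c) * of_bool (a \<le> b \<and> c < b)) = 0" .
qed

lemma balanced_peaks: "balanced n (\<lambda>\<sigma>. int (card (peaks n \<sigma>)))"
proof -
  have "int (card (peaks n \<sigma>)) =
      (\<Sum>i\<in>{1..<n - 1}. of_bool (\<sigma> i < \<sigma> (i + 1) \<and> \<sigma> (i + 2) < \<sigma> (i + 1)))" if "\<sigma> \<in> Sym n" for \<sigma>
  proof -
    have "peaks n \<sigma> = {i \<in> {1..<n - 1}. \<sigma> i < \<sigma> (i + 1) \<and> \<sigma> (i + 2) < \<sigma> (i + 1)}"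
      using Sym_less_or_less[OF that] by (auto simp: peaks_def ascents_def descents_def)
    then show ?thesis
      by (simp only: card_filter_eq_sum finite_atLeastLessThan)
  qed
  then show ?thesis
    by (rule balanced_if_sum) (assumption, (rule balanced_peak_at; auto))
qed

text \<open>
  Each of the four up-down shapes at positions \<open>i, i + 1, i + 2\<close> is a combination of the peak
  indicator at \<open>i\<close> and the descent indicators at \<open>i\<close> and \<open>i + 1\<close>.
\<close>

lemma balanced_shape_at:
  assumes "1 \<le> i" "i + 2 \<le> n"
  shows "balanced n (\<lambda>\<sigma>. of_bool ((\<sigma> (i + 1) < \<sigma> i \<longleftrightarrow> p) \<and> (\<sigma> (i + 2) < \<sigma> (i + 1) \<longleftrightarrow> q)))"
proof -
  let ?D = "\<lambda>\<sigma>. of_bool (\<sigma> (i + 1) < \<sigma> i) :: int"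
  let ?E = "\<lambda>\<sigma>. of_bool (\<sigma> (i + 2) < \<sigma> (i + 1)) :: int"
  let ?P = "\<lambda>\<sigma>. of_bool (\<sigma> i < \<sigma> (i + 1) \<and> \<sigma> (i + 2) < \<sigma> (i + 1)) :: int"
  have D: "balanced n ?D" and E: "balanced n ?E" and P: "balanced n ?P"
    using balanced_descent_at[of i n] balanced_descent_at[of "i + 1" n] balanced_peak_at[OF assms] assms
    by (simp_all add: numeral_2_eq_2)
  have eq: "of_bool ((\<sigma> (i + 1) < \<sigma> i \<longleftrightarrow> p) \<and> (\<sigma> (i + 2) < \<sigma> (i + 1) \<longleftrightarrow> q)) =
     (if p then if q then ?E \<sigma> - ?P \<sigma> else (?D \<sigma> - ?E \<sigma>) + ?P \<sigma>
      else if q then ?P \<sigma> else (1 - ?D \<sigma>) - ?P \<sigma>)" if "\<sigma> \<in> Sym n" for \<sigma>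
    using Sym_less_or_less[OF that, of i "i + 1"] by (auto simp: of_bool_def)
  show ?thesis
    using eq by (subst balanced_cong, assumption)
      (cases p; cases q; simp only: if_True if_False;
       intro balanced_add balanced_diff balanced_const D E P)
qed

lemma balanced_shape_set:
  assumes "\<And>\<sigma>. \<sigma> \<in> Sym n \<Longrightarrow>
    A \<sigma> = {i \<in> {1..<n - 1}. (\<sigma> (i + 1) < \<sigma> i \<longleftrightarrow> p) \<and> (\<sigma> (i + 2) < \<sigma> (i + 1) \<longleftrightarrow> q)}"
  shows "balanced n (\<lambda>\<sigma>. int (card (A \<sigma>)))"
proof -
  have "int (card (A \<sigma>)) = (\<Sum>i\<in>{1..<n - 1}.
      of_bool ((\<sigma> (i + 1) < \<sigma> i \<longleftrightarrow> p) \<and> (\<sigma> (i + 2) < \<sigma> (i + 1) \<longleftrightarrow> q)))" if "\<sigma> \<in> Sym n" for \<sigma>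
    using assms[OF that] by (simp only: card_filter_eq_sum finite_atLeastLessThan)
  then show ?thesis
    by (rule balanced_if_sum) (assumption, (rule balanced_shape_at; auto))
qed

lemma balanced_valleys: "balanced n (\<lambda>\<sigma>. int (card (valleys n \<sigma>)))"
  by (rule balanced_shape_set[where p = True and q = False])
     (auto simp: valleys_def ascents_def descents_def)

lemma balanced_double_ascents: "balanced n (\<lambda>\<sigma>. int (card (double_ascents n \<sigma>)))"
proof (rule balanced_shape_set[where p = False and q = False])
  fix \<sigma> assume "\<sigma> \<in> Sym n"
  from Sym_less_or_less[OF this]
  show "double_ascents n \<sigma> =
      {i \<in> {1..<n - 1}. (\<sigma> (i + 1) < \<sigma> i) = False \<and> (\<sigma> (i + 2) < \<sigma> (i + 1)) = False}"
    by (fastforce simp: double_ascents_def)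
qed

lemma balanced_double_descents: "balanced n (\<lambda>\<sigma>. int (card (double_descents n \<sigma>)))"
  by (rule balanced_shape_set[where p = True and q = True]) (auto simp: double_descents_def)

lemma balanced_in_descents: "balanced n (\<lambda>\<sigma>. of_bool (i \<in> descents n \<sigma>))"
proof -
  have "of_bool (i \<in> descents n \<sigma>) = (\<Sum>j\<in>descents n \<sigma>. of_bool (j = i) :: int)" for \<sigma>
    using finite_descents by (simp add: of_bool_def)
  then show ?thesis
    by (simp only: balanced_descents_weighted)
qed

lemma balanced_in_ascents: "balanced n (\<lambda>\<sigma>. of_bool (i \<in> ascents n \<sigma>))"
proof -
  have "of_bool (i \<in> ascents n \<sigma>) = of_bool (i \<in> {1..<n}) - (of_bool (i \<in> descents n \<sigma>) :: int)" for \<sigma>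
    by (auto simp: ascents_def descents_def)
  then show ?thesis
    by (simp only: balanced_diff balanced_const balanced_in_descents)
qed

lemma finite_peaks: "finite (peaks n \<sigma>)"
  by (rule finite_subset[of _ "{1..<n}"]) (auto simp: peaks_def ascents_def)

lemma finite_valleys: "finite (valleys n \<sigma>)"
  by (rule finite_subset[of _ "{1..<n}"]) (auto simp: valleys_def descents_def)

lemma balanced_left_outer_peaks: "balanced n (\<lambda>\<sigma>. int (card (left_outer_peaks n \<sigma>)))"
proof -
  have "int (card (left_outer_peaks n \<sigma>)) = int (card (peaks n \<sigma>)) + of_bool (1 \<in> descents n \<sigma>)" for \<sigma>
  proof -
    have "left_outer_peaks n \<sigma> = peaks n \<sigma> \<union> (if 1 \<in> descents n \<sigma> then {1} else {})"
      by (auto simp: left_outer_peaks_def)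
    moreover have "1 \<in> descents n \<sigma> \<Longrightarrow> 1 \<notin> peaks n \<sigma>"
      by (auto simp: peaks_def ascents_def)
    ultimately show ?thesis
      using finite_peaks by simp
  qed
  then show ?thesis
    by (simp only: balanced_add balanced_peaks balanced_in_descents)
qed

lemma balanced_right_outer_peaks: "balanced n (\<lambda>\<sigma>. int (card (right_outer_peaks n \<sigma>)))"
proof -
  have "int (card (right_outer_peaks n \<sigma>)) = int (card (peaks n \<sigma>)) + of_bool (n - 1 \<in> ascents n \<sigma>)" for \<sigma>
  proof -
    have "right_outer_peaks n \<sigma> = peaks n \<sigma> \<union> (if n - 1 \<in> ascents n \<sigma> then {n - 1} else {})"
      by (auto simp: right_outer_peaks_def)
    moreover have "n - 1 \<notin> peaks n \<sigma>"
      by (auto simp: peaks_def descents_def)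
    ultimately show ?thesis
      using finite_peaks by simp
  qed
  then show ?thesis
    by (simp only: balanced_add balanced_peaks balanced_in_ascents)
qed

lemma balanced_num_outer_peaks: "balanced n (\<lambda>\<sigma>. int (num_outer_peaks n \<sigma>))"
  unfolding num_outer_peaks_def of_nat_add of_nat_of_bool
  by (intro balanced_add balanced_peaks balanced_in_ascents balanced_in_descents)

lemma balanced_num_valleys_with_boundary: "balanced n (\<lambda>\<sigma>. int (num_valleys_with_boundary n \<sigma>))"
  unfolding num_valleys_with_boundary_def of_nat_add of_nat_of_bool
  by (intro balanced_add balanced_valleys balanced_in_ascents balanced_in_descents)

lemma balanced_switches: "balanced n (\<lambda>\<sigma>. int (card (peaks n \<sigma>) + card (valleys n \<sigma>)))"
  unfolding of_nat_add by (intro balanced_add balanced_peaks balanced_valleys)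

section \<open>Runs and monotone runs as maximal segments\<close>

text \<open>A maximal segment is determined by its right end \<open>b\<close>, where it stops by condition \<open>R\<close>.\<close>

lemma card_maximal_segments:
  assumes n: "1 \<le> n"
    and hered: "\<And>a b a' b'. a \<le> a' \<Longrightarrow> b' \<le> b \<Longrightarrow> P {a..b} \<Longrightarrow> P {a'..b'}"
    and single: "\<And>b. P {b..b}"
    and R: "\<And>a b. 1 \<le> a \<Longrightarrow> a \<le> b \<Longrightarrow> b < n \<Longrightarrow> P {a..b} \<Longrightarrow>
      (\<And>a'. 1 \<le> a' \<Longrightarrow> P {a'..b} \<Longrightarrow> a \<le> a') \<Longrightarrow> P {a..b + 1} \<longleftrightarrow> \<not> R b"
  shows "card (maximal_segments n P) = card {b \<in> {1..<n}. R b} + 1"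
proof -
  \<comment> \<open>The leftmost start of a good segment ending at \<open>b\<close>; this is the
    left end that goes with \<open>b\<close>.\<close>
  define l where "l = (\<lambda>b. LEAST a. 1 \<le> a \<and> P {a..b})"
  have l: "1 \<le> l b" "P {l b..b}" "l b \<le> b" if "1 \<le> b" for b
  proof -
    have ex: "1 \<le> b \<and> P {b..b}"
      using that single by simp
    show "1 \<le> l b" "P {l b..b}"
      using LeastI[of "\<lambda>a. 1 \<le> a \<and> P {a..b}" b, OF ex] by (auto simp: l_def)
    show "l b \<le> b"
      unfolding l_def using ex by (intro Least_le)
  qed
  have l_le: "l b \<le> a" if "1 \<le> a" "P {a..b}" for a b
    unfolding l_def by (rule Least_le) (use that in simp)
  \<comment> \<open>The assumption on \<open>R\<close> speaks only of segments that cannot be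
    extended to the left, and \<open>{l b..b}\<close> is one.\<close>
  have Rl: "P {l b..b + 1} \<longleftrightarrow> \<not> R b" if "1 \<le> b" "b < n" for b
    using R[of "l b" b] l[of b] l_le that by blast
  let ?E = "insert n {b \<in> {1..<n}. R b}"
  have "maximal_segments n P = (\<lambda>b. (l b, b)) ` ?E"
  proof (intro equalityI subsetI)
    fix x assume "x \<in> maximal_segments n P"
    then obtain a b where x: "x = (a, b)" and ab: "1 \<le> a" "a \<le> b" "b \<le> n" "P {a..b}"
      and max: "\<And>a' b'. 1 \<le> a' \<and> a' \<le> a \<and> b \<le> b' \<and> b' \<le> n \<and> P {a'..b'} \<Longrightarrow> a' = a \<and> b' = b"
      unfolding maximal_segments_def by blast
    have a: "l b = a"
      using max[of "l b" b] l[of b] l_le[of a b] ab by auto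
    have "R b" if "b < n"
      using max[of a "b + 1"] Rl[of b] that ab a by auto
    then have "b \<in> ?E"
      using ab by auto
    then show "x \<in> (\<lambda>b. (l b, b)) ` ?E"
      using x a by auto
  next
    fix x assume "x \<in> (\<lambda>b. (l b, b)) ` ?E"
    then obtain b where x: "x = (l b, b)" and b: "1 \<le> b" "b \<le> n" "b < n \<Longrightarrow> R b"
      using n by auto
    have "a' = l b \<and> b' = b"
      if "1 \<le> a'" "a' \<le> l b" "b \<le> b'" "b' \<le> n" "P {a'..b'}" for a' b'
    proof -
      have "P {a'..b}"
        using hered[of a' a' b b'] that by simp
      then have a': "a' = l b"
        using l_le[of a' b] that by simp
      have "b' = b"
      proof (rule ccontr)
        assume "b' \<noteq> b"
        then have "P {l b..b + 1}" "b < n"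
          using hered[of "l b" "l b" "b + 1" b'] that a' by auto
        then show False
          using Rl[of b] b by auto
      qed
      with a' show ?thesis ..
    qed
    then show "x \<in> maximal_segments n P"
      using x b l[of b] unfolding maximal_segments_def by auto
  qed
  moreover have "inj_on (\<lambda>b. (l b, b)) ?E"
    by (auto simp: inj_on_def)
  ultimately show ?thesis
    by (simp add: card_image)
qed

lemma strict_mono_on_interval_iff:
  fixes \<sigma> :: "nat \<Rightarrow> nat"
  shows "strict_mono_on {a..b} \<sigma> \<longleftrightarrow> (\<forall>i. a \<le> i \<and> i < b \<longrightarrow> \<sigma> i < \<sigma> (i + 1))"
proof (intro iffI strict_mono_onI allI impI)
  fix r s assume *: "\<forall>i. a \<le> i \<and> i < b \<longrightarrow> \<sigma> i < \<sigma> (i + 1)" "r \<in> {a..b}" "s \<in> {a..b}" "r < s"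
  have "s \<le> b \<Longrightarrow> \<sigma> r < \<sigma> s"
    using \<open>r < s\<close>
  proof (induction s)
    case (Suc s)
    have "\<sigma> s < \<sigma> (Suc s)"
      using * Suc.prems by auto
    then show ?case
      using Suc by (cases "r = s") auto
  qed simp
  then show "\<sigma> r < \<sigma> s"
    using * by simp
qed (auto simp: strict_mono_on_def monotone_on_def)

lemma strict_antimono_on_interval_iff:
  fixes \<sigma> :: "nat \<Rightarrow> nat"
  shows "strict_antimono_on {a..b} \<sigma> \<longleftrightarrow> (\<forall>i. a \<le> i \<and> i < b \<longrightarrow> \<sigma> (i + 1) < \<sigma> i)"
proof
  assume *: "\<forall>i. a \<le> i \<and> i < b \<longrightarrow> \<sigma> (i + 1) < \<sigma> i"
  have "\<sigma> s < \<sigma> r" if "a \<le> r" "r < s" "s \<le> b" for r s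
    using that(2,3)
  proof (induction s)
    case (Suc s)
    have "\<sigma> (Suc s) < \<sigma> s"
      using * that(1) Suc.prems by auto
    then show ?case
      using Suc by (cases "r = s") auto
  qed simp
  then show "strict_antimono_on {a..b} \<sigma>"
    by (auto simp: monotone_on_def)
qed (auto simp: monotone_on_def)

lemma card_runs:
  assumes \<sigma>: "\<sigma> \<in> Sym n" and "1 \<le> n"
  shows "card (runs n \<sigma>) = card (descents n \<sigma>) + 1"
  unfolding runs_def descents_def
proof (rule card_maximal_segments[OF assms(2)])
  fix a b :: nat
  assume ab: "a \<le> b" "strict_mono_on {a..b} \<sigma>"
  then have "strict_mono_on {a..b + 1} \<sigma> \<longleftrightarrow> \<sigma> b < \<sigma> (b + 1)"
    unfolding strict_mono_on_interval_iff by (auto simp: less_Suc_eq)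
  then show "strict_mono_on {a..b + 1} \<sigma> \<longleftrightarrow> \<not> \<sigma> (b + 1) < \<sigma> b"
    using Sym_less_or_less[OF \<sigma>, of "b + 1" b] by simp
qed (simp_all only: strict_mono_on_interval_iff, auto)

text \<open>A segment of at least two points has a direction and stops exactly at a turning point. A
  single point has none and could be continued either way, so the stopping rule depends on
  left-maximality: only at \<open>b = 1\<close> is the segment a single point.\<close>

lemma card_maximal_monotone_segments:
  assumes \<sigma>: "\<sigma> \<in> Sym n" and n: "1 \<le> n"
  shows "card (maximal_segments n (\<lambda>A. strict_mono_on A \<sigma> \<or> strict_antimono_on A \<sigma>)) =
    card (peaks n \<sigma>) + card (valleys n \<sigma>) + 1"
proof -
  have turn: "b - 1 \<in> peaks n \<sigma> \<union> valleys n \<sigma> \<longleftrightarrow>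
      (\<sigma> (b - 1) < \<sigma> b \<longleftrightarrow> \<sigma> (b + 1) < \<sigma> b)" if "2 \<le> b" "b < n" for b
  proof -
    have "\<sigma> (b - 1) \<noteq> \<sigma> b" "\<sigma> b \<noteq> \<sigma> (b + 1)"
      using that by (auto simp: Sym_eq_iff[OF \<sigma>])
    then show ?thesis
      using that by (auto simp: peaks_def valleys_def ascents_def descents_def)
  qed
  have "card (maximal_segments n (\<lambda>A. strict_mono_on A \<sigma> \<or> strict_antimono_on A \<sigma>)) =
      card {b \<in> {1..<n}. 2 \<le> b \<and> b - 1 \<in> peaks n \<sigma> \<union> valleys n \<sigma>} + 1"
  proof (rule card_maximal_segments[OF n])
    fix a b :: nat
    assume ab: "1 \<le> a" "a \<le> b" "b < n" "strict_mono_on {a..b} \<sigma> \<or> strict_antimono_on {a..b} \<sigma>"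
      and min: "\<And>a'. 1 \<le> a' \<Longrightarrow> strict_mono_on {a'..b} \<sigma> \<or> strict_antimono_on {a'..b} \<sigma> \<Longrightarrow> a \<le> a'"
    have ne: "\<sigma> i \<noteq> \<sigma> (i + 1)" for i
      by (simp add: Sym_eq_iff[OF \<sigma>])
    show "strict_mono_on {a..b + 1} \<sigma> \<or> strict_antimono_on {a..b + 1} \<sigma> \<longleftrightarrow>
        \<not> (2 \<le> b \<and> b - 1 \<in> peaks n \<sigma> \<union> valleys n \<sigma>)"
    proof (cases "b = 1")
      case True
      then have "a = 1"
        using ab by simp
      then show ?thesis
        using True ne[of 1] unfolding strict_mono_on_interval_iff strict_antimono_on_interval_iff
        by (auto simp: less_Suc_eq le_Suc_eq)
    next
      case False
      then have b: "2 \<le> b"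
        using ab by simp
      \<comment> \<open>Two neighbouring positions always form a monotone segment, so by minimality
        of \<open>a\<close> the step from \<open>b - 1\<close> to \<open>b\<close> belongs to the
        segment and fixes its direction.\<close>
      have "strict_mono_on {b - 1..b} \<sigma> \<or> strict_antimono_on {b - 1..b} \<sigma>"
        using ne[of "b - 1"] b unfolding strict_mono_on_interval_iff strict_antimono_on_interval_iff
        by (metis Suc_eq_plus1 Suc_diff_1 add_diff_inverse_nat le_antisym less_Suc_eq_le
            linorder_neqE_nat not_less_eq_eq less_one zero_less_iff_neq_zero pos2 less_le_trans)
      then have a: "a \<le> b - 1"
        using min[of "b - 1"] b by simp
      have step: "(\<forall>i. a \<le> i \<and> i < b + 1 \<longrightarrow> Q i) \<longleftrightarrow> (\<forall>i. a \<le> i \<and> i < b \<longrightarrow> Q i) \<and> Q b" for Q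
        using ab(2) by (auto simp: less_Suc_eq)
      have last: "(\<forall>i. a \<le> i \<and> i < b \<longrightarrow> Q i) \<Longrightarrow> Q (b - 1)" for Q
        using a b by auto
      have pred: "b - 1 + 1 = b"
        using b by simp
      show ?thesis
        using ab(4) turn[OF b ab(3)] b ne[of b] ne[of "b - 1"]
          last[of "\<lambda>i. \<sigma> i < \<sigma> (i + 1)"] last[of "\<lambda>i. \<sigma> (i + 1) < \<sigma> i"]
        unfolding strict_mono_on_interval_iff strict_antimono_on_interval_iff step pred
        by (metis linorder_neqE_nat less_asym)
    qed
  qed (simp_all only: strict_mono_on_interval_iff strict_antimono_on_interval_iff, auto)
  \<comment> \<open>A peak or valley with index \<open>i\<close> turns at position
    \<open>i + 1\<close>, hence \<open>Suc\<close>.\<close>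
  also have "{b \<in> {1..<n}. 2 \<le> b \<and> b - 1 \<in> peaks n \<sigma> \<union> valleys n \<sigma>} =
      Suc ` (peaks n \<sigma> \<union> valleys n \<sigma>)" (is "?L = ?R")
  proof (intro equalityI subsetI)
    fix b assume "b \<in> ?L"
    then show "b \<in> ?R"
      by (intro image_eqI[of _ _ "b - 1"]) auto
  qed (auto simp: peaks_def valleys_def ascents_def descents_def)
  also have "card \<dots> = card (peaks n \<sigma>) + card (valleys n \<sigma>)"
    by (subst card_image, simp, subst card_Un_disjoint)
       (auto simp: finite_peaks finite_valleys, auto simp: peaks_def valleys_def ascents_def)
  finally show ?thesis
    by simp
qed

lemma balanced_runs:
  assumes "1 \<le> n"
  shows "balanced n (\<lambda>\<sigma>. int (card (runs n \<sigma>)))"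
proof -
  have "balanced n (\<lambda>\<sigma>. int (card (descents n \<sigma>)) + 1)"
    by (intro balanced_add balanced_descents balanced_const)
  then show ?thesis
    using card_runs[OF _ assms]
    by (subst balanced_cong[where g = "\<lambda>\<sigma>. int (card (descents n \<sigma>)) + 1"]) simp_all
qed

lemma balanced_num_updown_runs:
  assumes "1 \<le> n"
  shows "balanced n (\<lambda>\<sigma>. int (num_updown_runs n \<sigma>))"
proof -
  let ?g = "\<lambda>\<sigma>. int (card (peaks n \<sigma>)) + int (card (valleys n \<sigma>)) + 1 + of_bool (1 \<in> descents n \<sigma>)"
  have "balanced n ?g"
    by (intro balanced_add balanced_peaks balanced_valleys balanced_in_descents balanced_const)
  moreover have "int (num_updown_runs n \<sigma>) = ?g \<sigma>" if "\<sigma> \<in> Sym n" for \<sigma>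
    unfolding num_updown_runs_def card_maximal_monotone_segments[OF that assms] by simp
  ultimately show ?thesis
    by (subst balanced_cong)
qed

section \<open>Descents of distance 2\<close>

text \<open>Summing over \<open>a\<close> first leaves only the parity of
  \<open>c + of_bool (b \<le> c)\<close>. Counting the \<open>b\<close> that make it even leaves a
  signed sum over \<open>c\<close> in closed form, which vanishes over the full range.\<close>

lemma sum_descent2_alternating:
  assumes "even m"
  shows "(\<Sum>a<m + 2. \<Sum>b<m + 1. \<Sum>c<m. (-1 :: int) ^ (a + c) * of_bool (c + of_bool (b \<le> c) < a)) = 0"
proof -
  \<comment> \<open>The full alternating sum has the even length \<open>m + 2\<close> and vanishes,
    so the tail is minus the initial part of length \<open>u + 1\<close>.\<close>
  have inner: "(\<Sum>a<m + 2. (-1 :: int) ^ a * of_bool (u < a)) = - of_bool (even u)"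
    if "u < m + 2" for u
  proof -
    have "(\<Sum>a<m + 2. (-1 :: int) ^ a * of_bool (u < a)) + (\<Sum>a<u + 1. (-1) ^ a) =
        (\<Sum>a<m + 2. (-1 :: int) ^ a * of_bool (u < a)) + (\<Sum>a<m + 2. (-1) ^ a * of_bool (a \<le> u))"
      by (intro arg_cong2[where f = plus] refl sum.mono_neutral_cong_left) (use that in auto)
    also have "\<dots> = (\<Sum>a<m + 2. (-1) ^ a)"
      by (subst sum.distrib[symmetric]) (intro sum.cong, auto)
    finally show ?thesis
      using assms unfolding sum_alternating by simp
  qed
  have count: "(\<Sum>b<m + 1. of_bool (even (c + of_bool (b \<le> c))) :: int) =
      (if even c then int m - int c else int c + 1)" if "c < m" for c
  proof -
    have "(\<Sum>b<m + 1. of_bool (even (c + of_bool (b \<le> c))) :: int) =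
        (if even c then int (card {c<..<m + 1}) else int (card {..c}))"
    proof (cases "even c")
      case True
      then have "{b. even (c + of_bool (b \<le> c))} \<inter> {..<m + 1} = {c<..<m + 1}"
        by auto
      then show ?thesis
        using True by (simp add: Int_commute del: sum.lessThan_Suc)
    next
      case False
      then have "{b. even (c + of_bool (b \<le> c))} \<inter> {..<m + 1} = {..c}"
        using that by auto
      then show ?thesis
        using False by (simp add: Int_commute del: sum.lessThan_Suc)
    qed
    then show ?thesis
      using that by (simp add: of_nat_diff)
  qed
  have "(\<Sum>a<m + 2. \<Sum>b<m + 1. \<Sum>c<m. (-1 :: int) ^ (a + c) * of_bool (c + of_bool (b \<le> c) < a)) =
      (\<Sum>c<m. \<Sum>b<m + 1. \<Sum>a<m + 2. (-1 :: int) ^ (a + c) * of_bool (c + of_bool (b \<le> c) < a))"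
    by (simp only: sum.swap[of _ "{..<m}" "{..<m + 1}"] sum.swap[of _ "{..<m}" "{..<m + 2}"]
        sum.swap[of _ "{..<m + 1}" "{..<m + 2}"])
  also have "\<dots> = (\<Sum>c<m. \<Sum>b<m + 1. (-1) ^ c * (\<Sum>a<m + 2. (-1) ^ a * of_bool (c + of_bool (b \<le> c) < a)))"
    by (simp only: power_add sum_distrib_left ac_simps)
  also have "\<dots> = (\<Sum>c<m. \<Sum>b<m + 1. (-1) ^ c * (- of_bool (even (c + of_bool (b \<le> c)))))"
    by (intro sum.cong refl arg_cong2[where f = times] inner) auto
  also have "\<dots> = - (\<Sum>c<m. (-1) ^ c * (\<Sum>b<m + 1. of_bool (even (c + of_bool (b \<le> c)))))"
    by (simp only: sum_distrib_left sum_negf mult_minus_right)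
  also have "\<dots> = - (\<Sum>c<m. if even c then int m - int c else - (int c + 1))"
    by (intro arg_cong[where f = uminus] sum.cong refl) (auto simp only: count lessThan_iff, auto)
  \<comment> \<open>\<open>M\<close> is decoupled from the bound \<open>2 * j\<close> to allow
    induction on \<open>j\<close>; with \<open>M = 2 * j\<close> the right-hand side is
    zero.\<close>
  also have "(\<Sum>c<2 * j. if even c then M - int c else - (int c + 1)) = int j * M - 2 * int j * int j"
    for j M by (induction j) (auto simp: algebra_simps)
  then have "(\<Sum>c<m. if even c then int m - int c else - (int c + 1)) = 0"
    using assms by (elim evenE) simp
  finally show ?thesis
    by simp
qed

lemma balanced_descent2_at:
  assumes "1 \<le> i" "i + 2 \<le> n"
  shows "balanced n (\<lambda>\<sigma>. of_bool (\<sigma> (i + 2) < \<sigma> i))"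
  by (rule balanced_code3[OF assms, where g = "\<lambda>a b c. of_bool (c + of_bool (b \<le> c) < a)"])
     (simp_all only: descent2_iff_lehmer_code[OF _ assms(2)] sum_descent2_alternating)

lemma balanced_descents_dist2: "balanced n (\<lambda>\<sigma>. int (card (descents_dist2 n \<sigma>)))"
proof -
  have "descents_dist2 n \<sigma> = {i \<in> {1..<n - 1}. \<sigma> (i + 2) < \<sigma> i}" for \<sigma>
    by (auto simp: descents_dist2_def)
  then have "int (card (descents_dist2 n \<sigma>)) = (\<Sum>i\<in>{1..<n - 1}. of_bool (\<sigma> (i + 2) < \<sigma> i))" for \<sigma>
    by (simp only: card_filter_eq_sum finite_atLeastLessThan)
  then show ?thesis
    by (rule balanced_if_sum) (rule balanced_descent2_at; auto)
qed

lemma finite_descents_dist2: "finite (descents_dist2 n \<sigma>)"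
  by (rule finite_subset[of _ "{..n}"]) (auto simp: descents_dist2_def)

lemma balanced_ascents_dist2: "balanced n (\<lambda>\<sigma>. int (card (ascents_dist2 n \<sigma>)))"
proof -
  let ?A = "{i. 1 \<le> i \<and> i + 2 \<le> n}"
  have "int (card (ascents_dist2 n \<sigma>)) = int (card ?A) - int (card (descents_dist2 n \<sigma>))" for \<sigma>
  proof -
    have "descents_dist2 n \<sigma> \<subseteq> ?A" "finite ?A"
      by (auto simp: descents_dist2_def intro: finite_subset[of _ "{..n}"])
    then show ?thesis
      unfolding ascents_dist2_def by (simp only: card_Diff_subset finite_descents_dist2 card_mono of_nat_diff)
  qed
  then show ?thesis
    by (simp only: balanced_diff balanced_const balanced_descents_dist2)
qed

section \<open>Inversions and patterns\<close>

text \<open>\<open>h i\<close> restores coordinates that are determined by \<open>i\<close>, such as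
  the position \<open>i + 1\<close> in a vincular occurrence, so that only the free ones are
  counted.\<close>

lemma card_image_Sigma:
  assumes "finite A" "\<And>i. i \<in> A \<Longrightarrow> finite (B i)" "S = (\<lambda>(i, x). (i, h i x)) ` Sigma A B"
    "\<And>i. i \<in> A \<Longrightarrow> inj_on (h i) (B i)"
  shows "card S = (\<Sum>i\<in>A. card (B i))"
proof -
  have "inj_on (\<lambda>(i, x). (i, h i x)) (Sigma A B)"
    using assms(4) by (auto simp: inj_on_def)
  then show ?thesis
    using assms by (simp add: card_image)
qed

lemma balanced_inversions: "balanced n (\<lambda>\<sigma>. int (card (inversions n \<sigma>)))"
proof -
  have "inversions n \<sigma> = Sigma {1..n} (\<lambda>i. {j \<in> {i<..n}. \<sigma> j < \<sigma> i})" for \<sigma>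
    by (auto simp: inversions_def)
  then have "int (card (inversions n \<sigma>)) = (\<Sum>i\<in>{1..n}. int (lehmer_code n \<sigma> i))" for \<sigma>
    by (simp add: lehmer_code_def)
  then show ?thesis
    by (rule balanced_if_sum) (rule balanced_code1; simp)
qed

lemma balanced_noninversions: "balanced n (\<lambda>\<sigma>. int (card (noninversions n \<sigma>)))"
proof -
  have eq: "noninversions n \<sigma> = Sigma {1..n} (\<lambda>i. {j \<in> {i<..n}. \<sigma> i < \<sigma> j})" for \<sigma>
    by (auto simp: noninversions_def)
  have "int (card (noninversions n \<sigma>)) = (\<Sum>i\<in>{1..n}. int (n - i - lehmer_code n \<sigma> i))"
    if "\<sigma> \<in> Sym n" for \<sigma>
    unfolding eq by (subst card_SigmaI) (simp_all only: card_later_greater[OF that] of_nat_sum, auto)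
  then show ?thesis
    by (rule balanced_if_sum) (assumption, (rule balanced_code1[where g = "\<lambda>a. int (n - _ - a)"]; simp))
qed

lemma balanced_short_inversions: "balanced n (\<lambda>\<sigma>. int (card {(i, j) \<in> inversions n \<sigma>. j - i \<le> 2}))"
proof -
  have "int (card {(i, j) \<in> inversions n \<sigma>. j - i \<le> 2}) =
      int (card (descents n \<sigma>)) + int (card (descents_dist2 n \<sigma>))" for \<sigma>
  proof -
    have split: "{(i, j) \<in> inversions n \<sigma>. j - i \<le> 2} =
        (\<lambda>i. (i, i + 1)) ` descents n \<sigma> \<union> (\<lambda>i. (i, i + 2)) ` descents_dist2 n \<sigma>" (is "?L = ?R")
    proof (intro equalityI subsetI)
      fix x assume "x \<in> ?L"
      then obtain i j where x: "x = (i, j)" "(i, j) \<in> inversions n \<sigma>" "j - i \<le> 2"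
        by blast
      then have "j = i + 1 \<or> j = i + 2"
        by (auto simp: inversions_def)
      then show "x \<in> ?R"
        using x by (auto simp: inversions_def descents_def descents_dist2_def)
    qed (auto simp: inversions_def descents_def descents_dist2_def)
    have "card ?R = card ((\<lambda>i. (i, i + 1)) ` descents n \<sigma>) + card ((\<lambda>i. (i, i + 2)) ` descents_dist2 n \<sigma>)"
      by (rule card_Un_disjoint) (auto simp: finite_descents finite_descents_dist2)
    moreover have "inj_on (\<lambda>i. (i, i + 1)) (descents n \<sigma>)" "inj_on (\<lambda>i. (i, i + 2)) (descents_dist2 n \<sigma>)"
      by (auto simp: inj_on_def)
    ultimately show ?thesis
      unfolding split by (simp add: card_image)
  qed
  then show ?thesis
    by (simp only: balanced_add balanced_descents balanced_descents_dist2)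
qed

lemma balanced_entry_inversions:
  assumes "1 \<le> i"
  shows "balanced n (\<lambda>\<sigma>. int (card {j \<in> {i<..n}. \<sigma> j < \<sigma> i}))"
proof (cases "i \<le> n")
  case True
  show ?thesis
    by (rule balanced_code1[OF assms True, where g = int]) (simp add: lehmer_code_def)
next
  case False
  then have empty: "{i<..n} = {}"
    by simp
  show ?thesis
    unfolding empty by (simp add: balanced_const)
qed

section \<open>Vincular patterns\<close>

lemma same_relative_order_3:
  "same_relative_order [x, y, z] [p, q, r] \<longleftrightarrow>
    (x < y \<longleftrightarrow> p < q) \<and> (x < z \<longleftrightarrow> p < r) \<and> (y < x \<longleftrightarrow> q < p) \<and>
    (y < z \<longleftrightarrow> q < r) \<and> (z < x \<longleftrightarrow> r < p) \<and> (z < y \<longleftrightarrow> r < q)"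
  by (simp add: same_relative_order_def All_less_Suc numeral_3_eq_3) blast

lemma card_vinc_occurrences:
  "card (vinc_occurrences p n \<sigma>) =
    (\<Sum>i\<in>{1..<n}. card {k \<in> {i + 1<..n}. same_relative_order [\<sigma> i, \<sigma> (i + 1), \<sigma> k] p})"
proof (rule card_image_Sigma[where h = "\<lambda>i k. (i + 1, k)"])
  show "vinc_occurrences p n \<sigma> = (\<lambda>(i, k). (i, i + 1, k)) ` (SIGMA i:{1..<n}.
      {k \<in> {i + 1<..n}. same_relative_order [\<sigma> i, \<sigma> (i + 1), \<sigma> k] p})"
    by (auto simp: vinc_occurrences_def occurrences_def image_iff)
qed (auto simp: inj_on_def)

text \<open>With \<open>a\<close> and \<open>b\<close> the codes at \<open>i\<close> and
  \<open>i + 1\<close>, the \<open>n - (i + 1)\<close> positions after \<open>i + 1\<close> contain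
  \<open>b\<close> values below \<open>\<sigma> (i + 1)\<close> and \<open>a\<close> values below
  \<open>\<sigma> i\<close>, or \<open>a - 1\<close> at a descent, where \<open>a\<close> also
  counts position \<open>i + 1\<close>. The numbers of later values below both, between and above
  both follow, and these give \<open>G\<close> for all six patterns.\<close>

lemma balanced_vinc_occurrences:
  assumes "\<And>i \<sigma>. \<sigma> \<in> Sym n \<Longrightarrow> i < n \<Longrightarrow>
    card {k \<in> {i + 1<..n}. same_relative_order [\<sigma> i, \<sigma> (i + 1), \<sigma> k] p} =
    G i (lehmer_code n \<sigma> i) (lehmer_code n \<sigma> (i + 1))"
  shows "balanced n (\<lambda>\<sigma>. int (card (vinc_occurrences p n \<sigma>)))"
proof -
  have "int (card (vinc_occurrences p n \<sigma>)) =
      (\<Sum>i\<in>{1..<n}. int (card {k \<in> {i + 1<..n}. same_relative_order [\<sigma> i, \<sigma> (i + 1), \<sigma> k] p}))" for \<sigma>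
    by (simp only: card_vinc_occurrences of_nat_sum)
  then show ?thesis
  proof (rule balanced_if_sum)
    fix i assume "i \<in> {1..<n}"
    then show "balanced n (\<lambda>\<sigma>. int (card {k \<in> {i + 1<..n}. same_relative_order [\<sigma> i, \<sigma> (i + 1), \<sigma> k] p}))"
      using assms by (intro balanced_code2[where i = i and g = "\<lambda>a b. int (G i a b)"]) auto
  qed
qed

lemma card_later_less:
  assumes "\<sigma> \<in> Sym n" "i < n"
  shows "card {k \<in> {i + 1<..n}. \<sigma> k < \<sigma> i} =
    lehmer_code n \<sigma> i - of_bool (lehmer_code n \<sigma> (i + 1) < lehmer_code n \<sigma> i)"
  using lehmer_code_step[OF assms(2), of \<sigma>] descent_iff_lehmer_code[OF assms] by simp

lemma balanced_vinc_213: "balanced n (\<lambda>\<sigma>. int (card (vinc_occurrences [2, 1, 3] n \<sigma>)))"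
proof (rule balanced_vinc_occurrences[where G = "\<lambda>i a b. if b < a then n - (i + 1) - (a - 1) else 0"])
  fix i \<sigma> assume \<sigma>: "\<sigma> \<in> Sym n" and i: "i < n"
  have "{k \<in> {i + 1<..n}. same_relative_order [\<sigma> i, \<sigma> (i + 1), \<sigma> k] [2, 1, 3]} =
      (if \<sigma> (i + 1) < \<sigma> i then {i + 1<..n} - {k \<in> {i + 1<..n}. \<sigma> k < \<sigma> i} else {})"
    using Sym_less_or_less[OF \<sigma>, of _ i] by (auto simp: same_relative_order_3)
  moreover have "card ({i + 1<..n} - {k \<in> {i + 1<..n}. \<sigma> k < \<sigma> i}) =
      n - (i + 1) - card {k \<in> {i + 1<..n}. \<sigma> k < \<sigma> i}"
    by (subst card_Diff_subset) auto
  ultimately show "card {k \<in> {i + 1<..n}. same_relative_order [\<sigma> i, \<sigma> (i + 1), \<sigma> k] [2, 1, 3]} =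
      (if lehmer_code n \<sigma> (i + 1) < lehmer_code n \<sigma> i then n - (i + 1) - (lehmer_code n \<sigma> i - 1) else 0)"
    using card_later_less[OF \<sigma> i] descent_iff_lehmer_code[OF \<sigma> i] by (simp only: split: if_splits) simp_all
qed

text \<open>At an ascent the values below \<open>\<sigma> i\<close> are among those below
  \<open>\<sigma> (i + 1)\<close>, so the counts subtract. This serves \<open>13-2\<close> as well
  as the four-letter patterns, which choose two of these positions.\<close>

lemma card_between_ascent:
  assumes \<sigma>: "\<sigma> \<in> Sym n" and i: "i < n"
  shows "card {k \<in> {i + 1<..n}. \<sigma> i < \<sigma> k \<and> \<sigma> k < \<sigma> (i + 1)} =
    (if lehmer_code n \<sigma> (i + 1) < lehmer_code n \<sigma> i then 0
     else lehmer_code n \<sigma> (i + 1) - lehmer_code n \<sigma> i)"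
proof (cases "\<sigma> (i + 1) < \<sigma> i")
  case True
  then have "{k \<in> {i + 1<..n}. \<sigma> i < \<sigma> k \<and> \<sigma> k < \<sigma> (i + 1)} = {}"
    by auto
  then show ?thesis
    using True descent_iff_lehmer_code[OF \<sigma> i] by (simp only: card.empty if_True)
next
  case False
  have eq: "{k \<in> {i + 1<..n}. \<sigma> i < \<sigma> k \<and> \<sigma> k < \<sigma> (i + 1)} =
      {k \<in> {i + 1<..n}. \<sigma> k < \<sigma> (i + 1)} - {k \<in> {i + 1<..n}. \<sigma> k < \<sigma> i}"
    using Sym_less_or_less[OF \<sigma>, of _ i] by auto
  have "card \<dots> = card {k \<in> {i + 1<..n}. \<sigma> k < \<sigma> (i + 1)} - card {k \<in> {i + 1<..n}. \<sigma> k < \<sigma> i}"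
    by (rule card_Diff_subset) (use False in auto)
  then show ?thesis
    unfolding eq using False card_later_less[OF \<sigma> i] descent_iff_lehmer_code[OF \<sigma> i]
    by (simp only: if_False lehmer_code_def[symmetric] of_bool_eq diff_zero)
qed

lemma balanced_vinc_132: "balanced n (\<lambda>\<sigma>. int (card (vinc_occurrences [1, 3, 2] n \<sigma>)))"
proof (rule balanced_vinc_occurrences[where G = "\<lambda>i a b. if b < a then 0 else b - a"])
  fix i \<sigma> assume \<sigma>: "\<sigma> \<in> Sym n" and i: "i < n"
  have "{k \<in> {i + 1<..n}. same_relative_order [\<sigma> i, \<sigma> (i + 1), \<sigma> k] [1, 3, 2]} =
      {k \<in> {i + 1<..n}. \<sigma> i < \<sigma> k \<and> \<sigma> k < \<sigma> (i + 1)}"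
    by (auto simp: same_relative_order_3)
  then show "card {k \<in> {i + 1<..n}. same_relative_order [\<sigma> i, \<sigma> (i + 1), \<sigma> k] [1, 3, 2]} =
      (if lehmer_code n \<sigma> (i + 1) < lehmer_code n \<sigma> i then 0
       else lehmer_code n \<sigma> (i + 1) - lehmer_code n \<sigma> i)"
    by (simp only: card_between_ascent[OF \<sigma> i])
qed

lemma card_vinc_123_at:
  assumes \<sigma>: "\<sigma> \<in> Sym n" and i: "i < n"
  shows "card {k \<in> {i + 1<..n}. same_relative_order [\<sigma> i, \<sigma> (i + 1), \<sigma> k] [1, 2, 3]} =
    (if lehmer_code n \<sigma> (i + 1) < lehmer_code n \<sigma> i then 0 else n - (i + 1) - lehmer_code n \<sigma> (i + 1))"
proof -
  have "{k \<in> {i + 1<..n}. same_relative_order [\<sigma> i, \<sigma> (i + 1), \<sigma> k] [1, 2, 3]} =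
      (if \<sigma> (i + 1) < \<sigma> i then {} else {k \<in> {i + 1<..n}. \<sigma> (i + 1) < \<sigma> k})"
    using Sym_less_or_less[OF \<sigma>, of "i + 1" i] by (auto simp: same_relative_order_3)
  then show ?thesis
    using card_later_greater[OF \<sigma>, of "i + 1"] descent_iff_lehmer_code[OF \<sigma> i]
    by (simp only: card.empty split: if_splits) simp_all
qed

lemma balanced_vinc_123: "balanced n (\<lambda>\<sigma>. int (card (vinc_occurrences [1, 2, 3] n \<sigma>)))"
  using card_vinc_123_at
  by (rule balanced_vinc_occurrences[where G = "\<lambda>i a b. if b < a then 0 else n - (i + 1) - b"])

lemma balanced_vinc_312: "balanced n (\<lambda>\<sigma>. int (card (vinc_occurrences [3, 1, 2] n \<sigma>)))"
proof (rule balanced_vinc_occurrences[where G = "\<lambda>i a b. if b < a then a - 1 - b else 0"])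
  fix i \<sigma> assume \<sigma>: "\<sigma> \<in> Sym n" and i: "i < n"
  have eq: "{k \<in> {i + 1<..n}. same_relative_order [\<sigma> i, \<sigma> (i + 1), \<sigma> k] [3, 1, 2]} =
      (if \<sigma> (i + 1) < \<sigma> i
       then {k \<in> {i + 1<..n}. \<sigma> k < \<sigma> i} - {k \<in> {i + 1<..n}. \<sigma> k < \<sigma> (i + 1)} else {})"
    using Sym_less_or_less[OF \<sigma>, of _ "i + 1"] by (auto simp: same_relative_order_3)
  have diff: "card ({k \<in> {i + 1<..n}. \<sigma> k < \<sigma> i} - {k \<in> {i + 1<..n}. \<sigma> k < \<sigma> (i + 1)}) =
      card {k \<in> {i + 1<..n}. \<sigma> k < \<sigma> i} - card {k \<in> {i + 1<..n}. \<sigma> k < \<sigma> (i + 1)}"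
    if "\<sigma> (i + 1) < \<sigma> i"
    by (rule card_Diff_subset) (use that in auto)
  show "card {k \<in> {i + 1<..n}. same_relative_order [\<sigma> i, \<sigma> (i + 1), \<sigma> k] [3, 1, 2]} =
      (if lehmer_code n \<sigma> (i + 1) < lehmer_code n \<sigma> i
       then lehmer_code n \<sigma> i - 1 - lehmer_code n \<sigma> (i + 1) else 0)"
  proof (cases "\<sigma> (i + 1) < \<sigma> i")
    case True
    then show ?thesis
      unfolding eq using diff[OF True] descent_iff_lehmer_code[OF \<sigma> i]
      by (simp only: if_True card_later_less[OF \<sigma> i] lehmer_code_def[symmetric] of_bool_eq)
  next
    case False
    then show ?thesis
      unfolding eq using descent_iff_lehmer_code[OF \<sigma> i] by (simp only: if_False card.empty)
  qed
qed

lemma balanced_vinc_231: "balanced n (\<lambda>\<sigma>. int (card (vinc_occurrences [2, 3, 1] n \<sigma>)))"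
proof (rule balanced_vinc_occurrences[where G = "\<lambda>i a b. if b < a then 0 else a"])
  fix i \<sigma> assume \<sigma>: "\<sigma> \<in> Sym n" and i: "i < n"
  have "{k \<in> {i + 1<..n}. same_relative_order [\<sigma> i, \<sigma> (i + 1), \<sigma> k] [2, 3, 1]} =
      (if \<sigma> (i + 1) < \<sigma> i then {} else {k \<in> {i + 1<..n}. \<sigma> k < \<sigma> i})"
    using Sym_less_or_less[OF \<sigma>, of "i + 1" i] by (auto simp: same_relative_order_3)
  then show "card {k \<in> {i + 1<..n}. same_relative_order [\<sigma> i, \<sigma> (i + 1), \<sigma> k] [2, 3, 1]} =
      (if lehmer_code n \<sigma> (i + 1) < lehmer_code n \<sigma> i then 0 else lehmer_code n \<sigma> i)"
    using card_later_less[OF \<sigma> i] descent_iff_lehmer_code[OF \<sigma> i]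
    by (simp only: card.empty split: if_splits) simp_all
qed

lemma balanced_vinc_321: "balanced n (\<lambda>\<sigma>. int (card (vinc_occurrences [3, 2, 1] n \<sigma>)))"
proof (rule balanced_vinc_occurrences[where G = "\<lambda>i a b. if b < a then b else 0"])
  fix i \<sigma> assume \<sigma>: "\<sigma> \<in> Sym n" and i: "i < n"
  have "{k \<in> {i + 1<..n}. same_relative_order [\<sigma> i, \<sigma> (i + 1), \<sigma> k] [3, 2, 1]} =
      (if \<sigma> (i + 1) < \<sigma> i then {k \<in> {i + 1<..n}. \<sigma> k < \<sigma> (i + 1)} else {})"
    by (auto simp: same_relative_order_3)
  then show "card {k \<in> {i + 1<..n}. same_relative_order [\<sigma> i, \<sigma> (i + 1), \<sigma> k] [3, 2, 1]} =
      (if lehmer_code n \<sigma> (i + 1) < lehmer_code n \<sigma> i then lehmer_code n \<sigma> (i + 1) else 0)"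
    using descent_iff_lehmer_code[OF \<sigma> i]
    by (simp only: card.empty lehmer_code_def[of n \<sigma> "i + 1"] split: if_splits) simp_all
qed

lemma balanced_bs_stat: "balanced n (\<lambda>\<sigma>. int (bs_stat n \<sigma>))"
  unfolding bs_stat_def of_nat_add
  by (intro balanced_add balanced_vinc_132 balanced_vinc_213 balanced_vinc_321 balanced_descents)

lemma balanced_bs_stat': "balanced n (\<lambda>\<sigma>. int (bs_stat' n \<sigma>))"
  unfolding bs_stat'_def of_nat_add
  by (intro balanced_add balanced_vinc_132 balanced_vinc_312 balanced_vinc_321 balanced_descents)

lemma balanced_initial_123: "balanced n (\<lambda>\<sigma>. int (card (occurrences_initial_123 n \<sigma>)))"
proof (cases "1 < n")
  case True
  let ?K = "\<lambda>\<sigma>. {k \<in> {1 + 1<..n}. same_relative_order [\<sigma> 1, \<sigma> (1 + 1), \<sigma> k] [1, 2, 3]}"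
  have "occurrences_initial_123 n \<sigma> = (\<lambda>k. (1 :: nat, 2 :: nat, k)) ` ?K \<sigma>" for \<sigma>
    by (auto simp: occurrences_initial_123_def occurrences_def numeral_2_eq_2)
  moreover have "inj_on (\<lambda>k. (1 :: nat, 2 :: nat, k)) (?K \<sigma>)" for \<sigma>
    by (auto simp: inj_on_def)
  ultimately have "card (occurrences_initial_123 n \<sigma>) = card (?K \<sigma>)" for \<sigma>
    by (simp only: card_image)
  then show ?thesis
    by (intro balanced_code2[where i = 1 and g = "\<lambda>a b. int (if b < a then 0 else n - (1 + 1) - b)"])
       (use True in \<open>simp_all only: card_vinc_123_at\<close>)
next
  case False
  then have "occurrences_initial_123 n \<sigma> = {}" for \<sigma>
    by (auto simp: occurrences_initial_123_def occurrences_def)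
  then show ?thesis
    by (simp add: balanced_const)
qed

section \<open>Patterns counted by pairs of later positions\<close>

lemma card_less_pairs:
  fixes B :: "nat set"
  assumes "finite B"
  shows "card {(j, k). j \<in> B \<and> k \<in> B \<and> j < k} = card B choose 2"
  using assms
proof (induction B rule: finite_linorder_max_induct)
  case (insert b A)
  have "{(j, k). j \<in> insert b A \<and> k \<in> insert b A \<and> j < k} =
      {(j, k). j \<in> A \<and> k \<in> A \<and> j < k} \<union> A \<times> {b}"
    using insert.hyps by auto
  moreover have "card \<dots> = card {(j, k). j \<in> A \<and> k \<in> A \<and> j < k} + card (A \<times> {b})"
  proof (rule card_Un_disjoint)
    show "finite {(j, k). j \<in> A \<and> k \<in> A \<and> j < k}"
      by (rule finite_subset[of _ "A \<times> A"]) (use insert.hyps in auto)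
  qed (use insert.hyps in auto)
  moreover have "b \<notin> A"
    using insert.hyps by auto
  ultimately show ?case
    using insert by (simp add: numeral_2_eq_2)
qed simp

lemma finite_less_pairs: "finite B \<Longrightarrow> finite {(j, k :: nat). j \<in> B \<and> k \<in> B \<and> j < k}"
  by (rule finite_subset[of _ "B \<times> B"]) auto

lemma balanced_occurrences_14_23: "balanced n (\<lambda>\<sigma>. int (card (occurrences_14_23 n \<sigma>)))"
proof -
  define B where "B = (\<lambda>(\<sigma> :: nat \<Rightarrow> nat) i. {k \<in> {i + 1<..n}. \<sigma> i < \<sigma> k \<and> \<sigma> k < \<sigma> (i + 1)})"
  have fin: "finite (B \<sigma> i)" for \<sigma> i
    by (simp add: B_def)
  have "card (occurrences_14_23 n \<sigma>) = (\<Sum>i\<in>{1..<n}. card {(l, m). l \<in> B \<sigma> i \<and> m \<in> B \<sigma> i \<and> l < m})" for \<sigma>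
  proof (rule card_image_Sigma[where h = "\<lambda>i x. x"])
    show "occurrences_14_23 n \<sigma> = (\<lambda>(i, x). (i, x)) `
        (SIGMA i:{1..<n}. {(l, m). l \<in> B \<sigma> i \<and> m \<in> B \<sigma> i \<and> l < m})"
      by (auto simp: occurrences_14_23_def B_def)
  qed (auto simp: finite_less_pairs fin)
  then have "int (card (occurrences_14_23 n \<sigma>)) = (\<Sum>i\<in>{1..<n}. int (card (B \<sigma> i) choose 2))" for \<sigma>
    by (simp only: card_less_pairs fin of_nat_sum)
  then show ?thesis
  proof (rule balanced_if_sum)
    fix i assume i: "i \<in> {1..<n}"
    then show "balanced n (\<lambda>\<sigma>. int (card (B \<sigma> i) choose 2))"
      by (intro balanced_code2[where i = i and g = "\<lambda>a b. int ((if b < a then 0 else b - a) choose 2)"])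
         (simp_all only: B_def card_between_ascent atLeastLessThan_iff)
  qed
qed

text \<open>Used for two patterns with the same first letter. Their union forgets the order of the
  last two letters, so for fixed \<open>i\<close> only the number of later values below
  \<open>\<sigma> i\<close> matters, which is a single code entry.\<close>

lemma balanced_occurrences_pair:
  assumes disj: "\<And>x y z. \<not> (same_relative_order [x, y, z] p \<and> same_relative_order [x, y, z] q)"
    and count: "\<And>i \<sigma>. \<sigma> \<in> Sym n \<Longrightarrow> i \<in> {1..n} \<Longrightarrow>
      card {(j, k). j \<in> {i<..n} \<and> k \<in> {i<..n} \<and> j < k \<and>
        (same_relative_order [\<sigma> i, \<sigma> j, \<sigma> k] p \<or> same_relative_order [\<sigma> i, \<sigma> j, \<sigma> k] q)} =
      G i (lehmer_code n \<sigma> i)"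
  shows "balanced n (\<lambda>\<sigma>. int (card (occurrences p n \<sigma>) + card (occurrences q n \<sigma>)))"
proof -
  define B where "B = (\<lambda>\<sigma> i. {(j, k). j \<in> {i<..n} \<and> k \<in> {i<..n} \<and> j < k \<and>
    (same_relative_order [\<sigma> i, \<sigma> j, \<sigma> k] p \<or> same_relative_order [\<sigma> i, \<sigma> j, \<sigma> k] q)})"
  have fin: "finite (B \<sigma> i)" for \<sigma> i
    by (rule finite_subset[of _ "{..n} \<times> {..n}"]) (auto simp: B_def)
  have finocc: "finite (occurrences r n \<sigma>)" for r \<sigma>
    by (rule finite_subset[of _ "{..n} \<times> {..n} \<times> {..n}"]) (auto simp: occurrences_def)
  have "card (occurrences p n \<sigma>) + card (occurrences q n \<sigma>) = (\<Sum>i\<in>{1..n}. card (B \<sigma> i))" for \<sigma>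
  proof -
    have "card (occurrences p n \<sigma>) + card (occurrences q n \<sigma>) =
        card (occurrences p n \<sigma> \<union> occurrences q n \<sigma>)"
      by (rule card_Un_disjoint[symmetric]) (use disj in \<open>auto simp: finocc, auto simp: occurrences_def\<close>)
    also have "\<dots> = (\<Sum>i\<in>{1..n}. card (B \<sigma> i))"
    proof (rule card_image_Sigma[where h = "\<lambda>i x. x"])
      show "occurrences p n \<sigma> \<union> occurrences q n \<sigma> = (\<lambda>(i, x). (i, x)) ` (SIGMA i:{1..n}. B \<sigma> i)"
        by (auto simp: occurrences_def B_def)
    qed (auto simp: fin)
    finally show ?thesis .
  qed
  then have "int (card (occurrences p n \<sigma>) + card (occurrences q n \<sigma>)) = (\<Sum>i\<in>{1..n}. int (card (B \<sigma> i)))" for \<sigma>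
    by (simp only: of_nat_sum)
  then show ?thesis
  proof (rule balanced_if_sum)
    fix i assume i: "i \<in> {1..n}"
    show "balanced n (\<lambda>\<sigma>. int (card (B \<sigma> i)))"
    proof (rule balanced_code1[where i = i and g = "\<lambda>a. int (G i a)"])
      show "int (card (B \<sigma> i)) = int (G i (lehmer_code n \<sigma> i))" if "\<sigma> \<in> Sym n" for \<sigma>
        unfolding B_def by (simp only: count[OF that i])
    qed (use i in auto)
  qed
qed

lemma less_pairs_above:
  assumes \<sigma>: "\<sigma> \<in> Sym n"
  shows "{(j, k). j \<in> {i<..n} \<and> k \<in> {i<..n} \<and> j < k \<and>
      (same_relative_order [\<sigma> i, \<sigma> j, \<sigma> k] [1, 2, 3] \<or> same_relative_order [\<sigma> i, \<sigma> j, \<sigma> k] [1, 3, 2])} =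
    {(j, k). j \<in> {j \<in> {i<..n}. \<sigma> i < \<sigma> j} \<and> k \<in> {j \<in> {i<..n}. \<sigma> i < \<sigma> j} \<and> j < k}"
proof -
  have "same_relative_order [\<sigma> i, \<sigma> j, \<sigma> k] [1, 2, 3] \<or> same_relative_order [\<sigma> i, \<sigma> j, \<sigma> k] [1, 3, 2] \<longleftrightarrow>
      \<sigma> i < \<sigma> j \<and> \<sigma> i < \<sigma> k" if "i < j" "j < k" for j k
  proof -
    have "\<sigma> i \<noteq> \<sigma> j" "\<sigma> i \<noteq> \<sigma> k" "\<sigma> j \<noteq> \<sigma> k"
      using that by (auto simp: Sym_eq_iff[OF \<sigma>])
    then show ?thesis
      unfolding same_relative_order_3 by auto
  qed
  then show ?thesis
    by auto
qed

lemma less_pairs_below: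
  assumes \<sigma>: "\<sigma> \<in> Sym n"
  shows "{(j, k). j \<in> {i<..n} \<and> k \<in> {i<..n} \<and> j < k \<and>
      (same_relative_order [\<sigma> i, \<sigma> j, \<sigma> k] [3, 1, 2] \<or> same_relative_order [\<sigma> i, \<sigma> j, \<sigma> k] [3, 2, 1])} =
    {(j, k). j \<in> {j \<in> {i<..n}. \<sigma> j < \<sigma> i} \<and> k \<in> {j \<in> {i<..n}. \<sigma> j < \<sigma> i} \<and> j < k}"
proof -
  have "same_relative_order [\<sigma> i, \<sigma> j, \<sigma> k] [3, 1, 2] \<or> same_relative_order [\<sigma> i, \<sigma> j, \<sigma> k] [3, 2, 1] \<longleftrightarrow>
      \<sigma> j < \<sigma> i \<and> \<sigma> k < \<sigma> i" if "i < j" "j < k" for j k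
  proof -
    have "\<sigma> i \<noteq> \<sigma> j" "\<sigma> i \<noteq> \<sigma> k" "\<sigma> j \<noteq> \<sigma> k"
      using that by (auto simp: Sym_eq_iff[OF \<sigma>])
    then show ?thesis
      unfolding same_relative_order_3 by auto
  qed
  then show ?thesis
    by auto
qed

text \<open>The first letter is the middle one unless both later values lie on the same side of
  it.\<close>

lemma less_pairs_mixed:
  assumes \<sigma>: "\<sigma> \<in> Sym n"
  shows "{(j, k). j \<in> {i<..n} \<and> k \<in> {i<..n} \<and> j < k \<and>
      (same_relative_order [\<sigma> i, \<sigma> j, \<sigma> k] [2, 1, 3] \<or> same_relative_order [\<sigma> i, \<sigma> j, \<sigma> k] [2, 3, 1])} =
    {(j, k). j \<in> {i<..n} \<and> k \<in> {i<..n} \<and> j < k}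
    - {(j, k). j \<in> {j \<in> {i<..n}. \<sigma> i < \<sigma> j} \<and> k \<in> {j \<in> {i<..n}. \<sigma> i < \<sigma> j} \<and> j < k}
    - {(j, k). j \<in> {j \<in> {i<..n}. \<sigma> j < \<sigma> i} \<and> k \<in> {j \<in> {i<..n}. \<sigma> j < \<sigma> i} \<and> j < k}"
proof -
  have "same_relative_order [\<sigma> i, \<sigma> j, \<sigma> k] [2, 1, 3] \<or> same_relative_order [\<sigma> i, \<sigma> j, \<sigma> k] [2, 3, 1] \<longleftrightarrow>
      \<not> (\<sigma> i < \<sigma> j \<and> \<sigma> i < \<sigma> k) \<and> \<not> (\<sigma> j < \<sigma> i \<and> \<sigma> k < \<sigma> i)" if "i < j" "j < k" for j k
  proof -
    have "\<sigma> i \<noteq> \<sigma> j" "\<sigma> i \<noteq> \<sigma> k" "\<sigma> j \<noteq> \<sigma> k"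
      using that by (auto simp: Sym_eq_iff[OF \<sigma>])
    then show ?thesis
      unfolding same_relative_order_3 by auto
  qed
  then show ?thesis
    by auto
qed

lemma balanced_123_132:
  "balanced n (\<lambda>\<sigma>. int (card (occurrences [1, 2, 3] n \<sigma>) + card (occurrences [1, 3, 2] n \<sigma>)))"
proof (rule balanced_occurrences_pair[where G = "\<lambda>i a. (n - i - a) choose 2"])
  show "card {(j, k). j \<in> {i<..n} \<and> k \<in> {i<..n} \<and> j < k \<and>
      (same_relative_order [\<sigma> i, \<sigma> j, \<sigma> k] [1, 2, 3] \<or> same_relative_order [\<sigma> i, \<sigma> j, \<sigma> k] [1, 3, 2])} =
      (n - i - lehmer_code n \<sigma> i) choose 2" if "\<sigma> \<in> Sym n" for i \<sigma>
    unfolding less_pairs_above[OF that] by (subst card_less_pairs) (simp_all only: card_later_greater[OF that], simp)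
qed (auto simp: same_relative_order_3)

lemma balanced_312_321:
  "balanced n (\<lambda>\<sigma>. int (card (occurrences [3, 1, 2] n \<sigma>) + card (occurrences [3, 2, 1] n \<sigma>)))"
proof (rule balanced_occurrences_pair[where G = "\<lambda>i a. a choose 2"])
  show "card {(j, k). j \<in> {i<..n} \<and> k \<in> {i<..n} \<and> j < k \<and>
      (same_relative_order [\<sigma> i, \<sigma> j, \<sigma> k] [3, 1, 2] \<or> same_relative_order [\<sigma> i, \<sigma> j, \<sigma> k] [3, 2, 1])} =
      lehmer_code n \<sigma> i choose 2" if "\<sigma> \<in> Sym n" for i \<sigma>
    unfolding less_pairs_below[OF that] by (subst card_less_pairs) (simp_all only: lehmer_code_def, simp)
qed (auto simp: same_relative_order_3)

text \<open>The count is \<open>a * (n - i - a)\<close>, one later value on each side; the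
  complementary form with binomials lets \<open>card_less_pairs\<close> do all the counting.\<close>

lemma balanced_213_231:
  "balanced n (\<lambda>\<sigma>. int (card (occurrences [2, 1, 3] n \<sigma>) + card (occurrences [2, 3, 1] n \<sigma>)))"
proof (rule balanced_occurrences_pair[where
    G = "\<lambda>i a. (n - i choose 2) - (n - i - a choose 2) - (a choose 2)"])
  fix i \<sigma> assume \<sigma>: "\<sigma> \<in> Sym n"
  let ?T = "{(j, k). j \<in> {i<..n} \<and> k \<in> {i<..n} \<and> j < k}"
  let ?U = "{(j, k). j \<in> {j \<in> {i<..n}. \<sigma> i < \<sigma> j} \<and> k \<in> {j \<in> {i<..n}. \<sigma> i < \<sigma> j} \<and> j < k}"
  let ?D = "{(j, k). j \<in> {j \<in> {i<..n}. \<sigma> j < \<sigma> i} \<and> k \<in> {j \<in> {i<..n}. \<sigma> j < \<sigma> i} \<and> j < k}"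
  have fin: "finite {j \<in> {i<..n}. \<sigma> i < \<sigma> j}" "finite {j \<in> {i<..n}. \<sigma> j < \<sigma> i}"
    by auto
  have "card (?T - ?U - ?D) = card (?T - ?U) - card ?D"
    by (rule card_Diff_subset, rule finite_less_pairs[OF fin(2)]) auto
  also have "card (?T - ?U) = card ?T - card ?U"
    by (rule card_Diff_subset, rule finite_less_pairs[OF fin(1)]) auto
  finally show "card {(j, k). j \<in> {i<..n} \<and> k \<in> {i<..n} \<and> j < k \<and>
      (same_relative_order [\<sigma> i, \<sigma> j, \<sigma> k] [2, 1, 3] \<or> same_relative_order [\<sigma> i, \<sigma> j, \<sigma> k] [2, 3, 1])} =
      (n - i choose 2) - (n - i - lehmer_code n \<sigma> i choose 2) - (lehmer_code n \<sigma> i choose 2)"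
    unfolding less_pairs_mixed[OF \<sigma>]
    by (simp only: card_less_pairs fin finite_greaterThanAtMost card_greaterThanAtMost
        card_later_greater[OF \<sigma>] lehmer_code_def[symmetric])
qed (auto simp: same_relative_order_3)

section \<open>Extremal entries and the first entry\<close>

lemma rl_maximum_iff:
  "(\<forall>j\<in>{i<..n}. \<sigma> j < \<sigma> i) \<longleftrightarrow> lehmer_code n \<sigma> i = n - i"
proof
  assume "lehmer_code n \<sigma> i = n - i"
  then have "card {j \<in> {i<..n}. \<sigma> j < \<sigma> i} = card {i<..n}"
    by (simp add: lehmer_code_def)
  then have "{j \<in> {i<..n}. \<sigma> j < \<sigma> i} = {i<..n}"
    by (intro card_subset_eq) auto
  then show "\<forall>j\<in>{i<..n}. \<sigma> j < \<sigma> i"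
    by blast
next
  assume "\<forall>j\<in>{i<..n}. \<sigma> j < \<sigma> i"
  then have "{j \<in> {i<..n}. \<sigma> j < \<sigma> i} = {i<..n}"
    by blast
  then show "lehmer_code n \<sigma> i = n - i"
    by (simp add: lehmer_code_def)
qed

lemma rl_minimum_iff:
  assumes "\<sigma> \<in> Sym n"
  shows "(\<forall>j\<in>{i<..n}. \<sigma> i < \<sigma> j) \<longleftrightarrow> lehmer_code n \<sigma> i = 0"
proof -
  have "\<sigma> i < \<sigma> j \<longleftrightarrow> \<not> \<sigma> j < \<sigma> i" if "i < j" for j
    using Sym_less_or_less[OF assms, of j i] that by simp
  then show ?thesis
    by (auto simp: lehmer_code_def)
qed

lemma balanced_rl_maxima: "balanced n (\<lambda>\<sigma>. int (card (rl_maxima n \<sigma>)))"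
proof -
  have "int (card (rl_maxima n \<sigma>)) = (\<Sum>i\<in>{1..n}. of_bool (lehmer_code n \<sigma> i = n - i))" for \<sigma>
    unfolding rl_maxima_def rl_maximum_iff by (simp only: card_filter_eq_sum finite_atLeastAtMost)
  then show ?thesis
    by (rule balanced_if_sum) (rule balanced_code1[where g = "\<lambda>a. of_bool (a = n - _)"]; simp)
qed

lemma balanced_rl_minima: "balanced n (\<lambda>\<sigma>. int (card (rl_minima n \<sigma>)))"
proof -
  have "int (card (rl_minima n \<sigma>)) = (\<Sum>i\<in>{1..n}. of_bool (lehmer_code n \<sigma> i = 0))"
    if "\<sigma> \<in> Sym n" for \<sigma>
    unfolding rl_minima_def rl_minimum_iff[OF that] by (simp only: card_filter_eq_sum finite_atLeastAtMost)
  then show ?thesis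
    by (rule balanced_if_sum) (assumption, (rule balanced_code1[where g = "\<lambda>a. of_bool (a = 0)"]; simp))
qed

lemma balanced_first_entry:
  assumes "1 \<le> n"
  shows "balanced n (\<lambda>\<sigma>. int (\<sigma> 1))"
  by (rule balanced_code1[where i = 1 and g = "\<lambda>a. int (a + 1)"])
     (use assms lehmer_code_first[OF _ assms] in auto)

lemma balanced_complete_ascent_tops:
  "balanced n (\<lambda>\<sigma>. int (card {i \<in> ascent_tops n \<sigma>. \<forall>v\<in>{1..<\<sigma> i}. \<exists>j\<in>{1..<i}. \<sigma> j = v}))"
proof -
  have "int (card {i \<in> ascent_tops n \<sigma>. \<forall>v\<in>{1..<\<sigma> i}. \<exists>j\<in>{1..<i}. \<sigma> j = v}) =
      (\<Sum>i\<in>{1..<n}. of_bool (lehmer_code n \<sigma> i \<le> lehmer_code n \<sigma> (i + 1) \<and> lehmer_code n \<sigma> (i + 1) = 0))"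
    if \<sigma>: "\<sigma> \<in> Sym n" for \<sigma>
  proof -
    have before: "(\<forall>v\<in>{1..<\<sigma> i}. \<exists>j\<in>{1..<i}. \<sigma> j = v) \<longleftrightarrow> lehmer_code n \<sigma> i = 0" if i: "i \<in> {1..n}" for i
    proof -
      have "\<sigma> i \<le> n"
        using Sym_in_iff[OF \<sigma>, of i] i by simp
      then have "{v \<in> {1..n} - \<sigma> ` {1..<i}. v < \<sigma> i} = {1..<\<sigma> i} - \<sigma> ` {1..<i}"
        by auto
      then have "lehmer_code n \<sigma> i = card ({1..<\<sigma> i} - \<sigma> ` {1..<i})"
        using lehmer_code_values[OF \<sigma>, of i] i by simp
      then show ?thesis
        by (auto simp: card_eq_0_iff)
    qed
    have "{i \<in> ascent_tops n \<sigma>. \<forall>v\<in>{1..<\<sigma> i}. \<exists>j\<in>{1..<i}. \<sigma> j = v} =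
        Suc ` {i \<in> {1..<n}. lehmer_code n \<sigma> i \<le> lehmer_code n \<sigma> (i + 1) \<and> lehmer_code n \<sigma> (i + 1) = 0}"
      (is "?L = Suc ` ?R")
    proof (intro equalityI subsetI)
      fix x assume x: "x \<in> ?L"
      then have "x - 1 \<in> ?R"
        using before[of x] ascent_iff_lehmer_code[OF \<sigma>, of "x - 1"] by (auto simp: ascent_tops_def)
      then show "x \<in> Suc ` ?R"
        using x by (intro image_eqI[of _ _ "x - 1"]) (auto simp: ascent_tops_def)
    next
      fix x assume "x \<in> Suc ` ?R"
      then obtain i where i: "x = i + 1" "i \<in> ?R"
        by auto
      then show "x \<in> ?L"
        using before[of x] ascent_iff_lehmer_code[OF \<sigma>, of i] by (auto simp: ascent_tops_def)
    qed
    then show ?thesis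
      by (simp only: card_image[OF inj_Suc] card_filter_eq_sum finite_atLeastLessThan)
  qed
  then show ?thesis
    by (rule balanced_if_sum)
       (assumption, (rule balanced_code2[where g = "\<lambda>a b. of_bool (a \<le> b \<and> b = 0)"]; simp))
qed

section \<open>The lexicographic rank\<close>

lemma one_line_lexord_iff:
  "(one_line n \<tau>, one_line n \<sigma>) \<in> lexord {(x, y). x < y} \<longleftrightarrow>
    (\<exists>i\<in>{1..n}. (\<forall>j\<in>{1..<i}. \<tau> j = \<sigma> j) \<and> \<tau> i < \<sigma> i)"
proof -
  have len: "length (one_line n \<sigma>) = n" "length (one_line n \<tau>) = n"
    by (simp_all add: one_line_def)
  have nth: "one_line n \<rho> ! k = \<rho> (k + 1)" if "k < n" for \<rho> k
    using that by (simp add: one_line_def del: upt_Suc)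
  have take: "take k (one_line n \<tau>) = take k (one_line n \<sigma>) \<longleftrightarrow> (\<forall>j\<in>{1..<k + 1}. \<tau> j = \<sigma> j)"
    if "k < n" for k
  proof -
    have "take k (one_line n \<tau>) = take k (one_line n \<sigma>) \<longleftrightarrow> (\<forall>l<k. \<tau> (l + 1) = \<sigma> (l + 1))"
      using that by (auto simp: list_eq_iff_nth_eq len nth)
    also have "\<dots> \<longleftrightarrow> (\<forall>j\<in>{1..<k + 1}. \<tau> j = \<sigma> j)"
    proof (intro iffI ballI)
      fix j assume "\<forall>l<k. \<tau> (l + 1) = \<sigma> (l + 1)" "j \<in> {1..<k + 1}"
      then show "\<tau> j = \<sigma> j"
        by (auto dest: spec[of _ "j - 1"])
    qed auto
    finally show ?thesis .
  qed
  have "(one_line n \<tau>, one_line n \<sigma>) \<in> lexord {(x, y). x < y} \<longleftrightarrow>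
      (\<exists>k<n. (\<forall>j\<in>{1..<k + 1}. \<tau> j = \<sigma> j) \<and> \<tau> (k + 1) < \<sigma> (k + 1))"
    unfolding lexord_take_index_conv using len nth take by auto
  also have "\<dots> \<longleftrightarrow> (\<exists>i\<in>{1..n}. (\<forall>j\<in>{1..<i}. \<tau> j = \<sigma> j) \<and> \<tau> i < \<sigma> i)"
  proof
    assume "\<exists>i\<in>{1..n}. (\<forall>j\<in>{1..<i}. \<tau> j = \<sigma> j) \<and> \<tau> i < \<sigma> i"
    then obtain i where "i \<in> {1..n}" "(\<forall>j\<in>{1..<i}. \<tau> j = \<sigma> j) \<and> \<tau> i < \<sigma> i"
      by blast
    then show "\<exists>k<n. (\<forall>j\<in>{1..<k + 1}. \<tau> j = \<sigma> j) \<and> \<tau> (k + 1) < \<sigma> (k + 1)"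
      by (intro exI[of _ "i - 1"]) auto
  qed (auto intro: bexI[of _ "_ + 1"])
  finally show ?thesis .
qed

text \<open>
  Comparing at the first position where two permutations differ is the same as comparing their
  codes there, and the later code entries are unconstrained.
\<close>

lemma card_lex_smaller_at:
  assumes \<sigma>: "\<sigma> \<in> Sym n" and i: "i \<in> {1..n}"
  shows "card {\<tau> \<in> Sym n. (\<forall>j\<in>{1..<i}. \<tau> j = \<sigma> j) \<and> \<tau> i < \<sigma> i} =
    lehmer_code n \<sigma> i * (\<Prod>j\<in>{i<..n}. n - j + 1)"
proof -
  let ?\<Phi> = "\<lambda>\<sigma>. restrict (lehmer_code n \<sigma>) {1..n}"
  let ?S = "{\<tau> \<in> Sym n. (\<forall>j\<in>{1..<i}. \<tau> j = \<sigma> j) \<and> \<tau> i < \<sigma> i}"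
  \<comment> \<open>The codes of the permutations in question form a box: fixed before
    \<open>i\<close>, strictly smaller at \<open>i\<close>, free afterwards.\<close>
  define B where "B = (\<lambda>j. if j < i then {lehmer_code n \<sigma> j} else if j = i then {..<lehmer_code n \<sigma> i}
    else {..n - j})"
  have S: "?S = {\<tau> \<in> Sym n. (\<forall>j\<in>{1..<i}. lehmer_code n \<tau> j = lehmer_code n \<sigma> j) \<and>
      lehmer_code n \<tau> i < lehmer_code n \<sigma> i}"
  proof (intro Collect_cong conj_cong refl)
    fix \<tau> assume \<tau>: "\<tau> \<in> Sym n"
    show "(\<forall>j\<in>{1..<i}. \<tau> j = \<sigma> j) \<longleftrightarrow> (\<forall>j\<in>{1..<i}. lehmer_code n \<tau> j = lehmer_code n \<sigma> j)"
      using lehmer_code_prefix_eq_iff[OF \<tau> \<sigma>, of i] i by auto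
    then show "\<tau> i < \<sigma> i \<longleftrightarrow> lehmer_code n \<tau> i < lehmer_code n \<sigma> i"
      if "\<forall>j\<in>{1..<i}. lehmer_code n \<tau> j = lehmer_code n \<sigma> j"
      using lehmer_code_less_iff[OF \<tau> \<sigma> i] that by blast
  qed
  have img: "?\<Phi> ` ?S = PiE {1..n} B"
  proof (intro equalityI subsetI)
    fix c assume "c \<in> ?\<Phi> ` ?S"
    then show "c \<in> PiE {1..n} B"
      unfolding S by (auto simp: B_def lehmer_code_le)
  next
    fix c assume c: "c \<in> PiE {1..n} B"
    have cB: "c j \<in> B j" if "j \<in> {1..n}" for j
      using c that by auto
    have "c j \<le> n - j" if "j \<in> {1..n}" for j
      using cB[OF that] lehmer_code_le[of n \<sigma> j] by (auto simp: B_def split: if_splits)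
    then have "c \<in> codes n"
      using c by (auto simp: codes_def PiE_def)
    then obtain \<tau> where \<tau>: "\<tau> \<in> Sym n" "c = ?\<Phi> \<tau>"
      using bij_betw_lehmer_code[of n] unfolding bij_betw_def by blast
    have "lehmer_code n \<tau> j \<in> B j" if "j \<in> {1..n}" for j
      using cB[OF that] that \<tau>(2) by simp
    then have "\<tau> \<in> ?S"
      unfolding S using \<tau>(1) i by (force simp: B_def)
    then show "c \<in> ?\<Phi> ` ?S"
      using \<tau>(2) by blast
  qed
  have "inj_on ?\<Phi> ?S"
    using bij_betw_lehmer_code[of n] unfolding bij_betw_def by (auto intro: inj_on_subset)
  then have "card ?S = card (PiE {1..n} B)"
    using card_image[of ?\<Phi> ?S] img by simp
  also have "\<dots> = (\<Prod>j\<in>{1..n}. card (B j))"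
    by (simp add: card_PiE)
  also have "{1..n} = {1..<i} \<union> ({i} \<union> {i<..n})"
    using i by auto
  also have "(\<Prod>j\<in>{1..<i} \<union> ({i} \<union> {i<..n}). card (B j)) =
      (\<Prod>j\<in>{1..<i}. card (B j)) * ((\<Prod>j\<in>{i}. card (B j)) * (\<Prod>j\<in>{i<..n}. card (B j)))"
    by (subst prod.union_disjoint, simp, simp, fastforce, subst prod.union_disjoint) auto
  also have "\<dots> = lehmer_code n \<sigma> i * (\<Prod>j\<in>{i<..n}. n - j + 1)"
    by (simp add: B_def)
  finally show ?thesis .
qed

text \<open>The code gives the digits of the rank minus one in the factorial number system: the
  weight \<open>?w i\<close> is \<open>(n - i)!\<close>. The smaller permutations are sorted by the
  first position where they differ from \<open>\<sigma>\<close>.\<close>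

lemma balanced_lex_rank: "balanced n (\<lambda>\<sigma>. int (lex_rank n \<sigma>))"
proof -
  let ?A = "\<lambda>\<sigma> i. {\<tau> \<in> Sym n. (\<forall>j\<in>{1..<i}. \<tau> j = \<sigma> j) \<and> \<tau> i < \<sigma> i}"
  let ?w = "\<lambda>i. \<Prod>j\<in>{i<..n}. n - j + 1"
  have rank: "int (lex_rank n \<sigma>) = 1 + (\<Sum>i\<in>{1..n}. int (lehmer_code n \<sigma> i * ?w i))" if \<sigma>: "\<sigma> \<in> Sym n" for \<sigma>
  proof -
    have "{\<tau> \<in> Sym n. (one_line n \<tau>, one_line n \<sigma>) \<in> lexord {(x, y). x < y}} = (\<Union>i\<in>{1..n}. ?A \<sigma> i)"
      unfolding one_line_lexord_iff by blast
    moreover have "card (\<Union>i\<in>{1..n}. ?A \<sigma> i) = (\<Sum>i\<in>{1..n}. card (?A \<sigma> i))"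
    proof (rule card_UN_disjoint)
      show "\<forall>i\<in>{1..n}. \<forall>j\<in>{1..n}. i \<noteq> j \<longrightarrow> ?A \<sigma> i \<inter> ?A \<sigma> j = {}"
      proof (intro ballI impI)
        fix i j assume "i \<in> {1..n}" "j \<in> {1..n}" "i \<noteq> j"
        then have "i \<in> {1..<j} \<or> j \<in> {1..<i}"
          by auto
        then show "?A \<sigma> i \<inter> ?A \<sigma> j = {}"
          by fastforce
      qed
    qed (auto simp: finite_Sym)
    ultimately show ?thesis
      unfolding lex_rank_def using card_lex_smaller_at[OF \<sigma>] by (simp del: One_nat_def)
  qed
  have "balanced n (\<lambda>\<sigma>. 1 + (\<Sum>i\<in>{1..n}. int (lehmer_code n \<sigma> i * ?w i)))"
  proof (intro balanced_add balanced_const balanced_sum)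
    fix i assume "i \<in> {1..n}"
    then show "balanced n (\<lambda>\<sigma>. int (lehmer_code n \<sigma> i * ?w i))"
      by (intro balanced_code1[where i = i and g = "\<lambda>a. int (a * ?w i)"]) auto
  qed
  then show ?thesis
    using balanced_cong[OF rank] by simp
qed

section \<open>The permutation tree\<close>

lemma set_tree_path_subset: "set (tree_path \<sigma> i) \<subseteq> insert 0 (\<sigma> ` {1..i})"
proof (induction i)
  case (Suc i)
  then show ?case
    by (fastforce dest: set_dropWhileD)
qed simp

lemma in_set_dropWhile: "x \<in> set xs \<Longrightarrow> \<not> P x \<Longrightarrow> x \<in> set (dropWhile P xs)"
  by (induction xs) auto

text \<open>All labels are positive, so \<open>dropWhile\<close> always stops at the root at the
  latest; hence \<open>tree_parent\<close> never takes the head of an empty list.\<close>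

lemma tree_path_root:
  assumes \<sigma>: "\<sigma> \<in> Sym n"
  shows "i \<le> n \<Longrightarrow> 0 \<in> set (tree_path \<sigma> i)"
proof (induction i)
  case (Suc i)
  then have "\<sigma> (Suc i) > 0"
    using Sym_in_iff[OF \<sigma>, of "Suc i"] by auto
  then show ?case
    using Suc in_set_dropWhile[of 0 "tree_path \<sigma> i" "\<lambda>v. \<not> v < \<sigma> (Suc i)"] by auto
qed simp

lemma tree_parent_in:
  assumes \<sigma>: "\<sigma> \<in> Sym n" and k: "k \<in> {1..n}"
  shows "tree_parent \<sigma> k \<in> set (tree_path \<sigma> (k - 1))" "tree_parent \<sigma> k \<in> set (tree_path \<sigma> k)"
proof -
  let ?d = "dropWhile (\<lambda>v. \<not> v < \<sigma> k) (tree_path \<sigma> (k - 1))"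
  have "\<sigma> k > 0"
    using Sym_in_iff[OF \<sigma>, of k] k by auto
  then have "0 \<in> set ?d"
    using tree_path_root[OF \<sigma>, of "k - 1"] k by (intro in_set_dropWhile) auto
  then have "?d \<noteq> []"
    by (metis empty_iff list.set(1))
  then have d: "tree_parent \<sigma> k \<in> set ?d"
    unfolding tree_parent_def by (rule hd_in_set)
  then show "tree_parent \<sigma> k \<in> set (tree_path \<sigma> (k - 1))"
    by (rule set_dropWhileD)
  obtain l where "k = Suc l"
    using k by (cases k) auto
  then show "tree_parent \<sigma> k \<in> set (tree_path \<sigma> k)"
    using d by simp
qed

text \<open>The path to the smaller entry \<open>\<sigma> (i + 1)\<close> discards
  \<open>\<sigma> i\<close>. Every later path is a suffix of the previous one with a new label in
  front, so a discarded node never returns.\<close>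

lemma descent_leaves_tree_path:
  assumes \<sigma>: "\<sigma> \<in> Sym n" and i: "1 \<le> i" "\<sigma> (i + 1) < \<sigma> i" and "i < j"
  shows "\<sigma> i \<notin> set (tree_path \<sigma> j)"
  using \<open>i < j\<close>
proof (induction j)
  case (Suc j)
  have ne: "\<sigma> (Suc j) \<noteq> \<sigma> i"
    using Suc.prems by (auto simp: Sym_eq_iff[OF \<sigma>])
  show ?case
  proof (cases "i = j")
    case True
    \<comment> \<open>The path to \<open>\<sigma> i\<close> starts with \<open>\<sigma> i\<close>,
      which is dropped, and continues with the root or earlier entries, all different from
      \<open>\<sigma> i\<close>.\<close>
    obtain l where l: "j = Suc l"
      using i True by (cases j) auto
    have "\<sigma> i > 0"
      using i by simp
    then have "\<sigma> i \<notin> set (tree_path \<sigma> l)"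
      using set_tree_path_subset[of \<sigma> l] True l by (auto simp: Sym_eq_iff[OF \<sigma>])
    then have "\<sigma> i \<notin> set (dropWhile (\<lambda>v. \<not> v < \<sigma> (Suc j)) (tree_path \<sigma> j))"
      using True i l by (auto dest!: set_dropWhileD)
    then show ?thesis
      using ne by simp
  next
    case False
    then show ?thesis
      using Suc ne by (auto dest: set_dropWhileD)
  qed
qed simp

text \<open>At an ascent the next entry becomes a child of \<open>\<sigma> i\<close>, the head of
  the current path. At a descent \<open>\<sigma> i\<close> leaves the path before it gets a child,
  and \<open>\<sigma> n\<close> has no successor. The leaves are therefore the descent tops and the
  last entry.\<close>

lemma card_tree_leaves:
  assumes \<sigma>: "\<sigma> \<in> Sym n" and n: "1 \<le> n"
  shows "card (tree_leaves n \<sigma>) = card (descents n \<sigma>) + 1"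
proof -
  have "tree_leaves n \<sigma> = \<sigma> ` insert n (descents n \<sigma>)"
  proof (intro equalityI subsetI)
    fix v assume v: "v \<in> tree_leaves n \<sigma>"
    have "tree_parent \<sigma> 1 = 0"
      using Sym_in_iff[OF \<sigma>, of 1] n by (simp add: tree_parent_def)
    then have "v \<noteq> 0"
      using v n by (force simp: tree_leaves_def)
    then have "v \<in> \<sigma> ` {1..n}"
      using v Sym_image[OF \<sigma>] by (auto simp: tree_leaves_def)
    then obtain i where i: "i \<in> {1..n}" "v = \<sigma> i"
      by blast
    have "i = n \<or> \<sigma> (i + 1) < \<sigma> i"
    proof (rule ccontr)
      assume "\<not> ?thesis"
      then have asc: "i < n" "\<sigma> i < \<sigma> (i + 1)"
        using i Sym_less_or_less[OF \<sigma>, of "i + 1" i] by auto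
      obtain l where "i = Suc l"
        using i by (cases i) auto
      then have "tree_parent \<sigma> (i + 1) = \<sigma> i"
        using asc by (simp add: tree_parent_def)
      then show False
        using v i asc by (auto simp: tree_leaves_def)
    qed
    then show "v \<in> \<sigma> ` insert n (descents n \<sigma>)"
      using i by (cases "i = n") (auto simp: descents_def)
  next
    fix v assume "v \<in> \<sigma> ` insert n (descents n \<sigma>)"
    then obtain i where i: "v = \<sigma> i" "i \<in> {1..n}" "i = n \<or> \<sigma> (i + 1) < \<sigma> i"
      using n by (auto simp: descents_def)
    have "v \<in> {1..n}"
      using Sym_in_iff[OF \<sigma>, of i] i by simp
    moreover have "tree_parent \<sigma> k \<noteq> v" if k: "k \<in> {1..n}" for k
    \<comment> \<open>For \<open>k \<le> i\<close> the node \<open>v\<close> is not yet in the tree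
      when \<open>\<sigma> k\<close> is attached. Afterwards a parent would have to survive on the
      path to \<open>\<sigma> k\<close>, from which \<open>v\<close> has gone.\<close>
    proof (cases "k \<le> i")
      case True
      then have "v \<notin> set (tree_path \<sigma> (k - 1))"
        using set_tree_path_subset[of \<sigma> "k - 1"] k i \<open>v \<in> {1..n}\<close> by (auto simp: Sym_eq_iff[OF \<sigma>])
      then show ?thesis
        using tree_parent_in(1)[OF \<sigma> k] by auto
    next
      case False
      then have "v \<notin> set (tree_path \<sigma> k)"
        using descent_leaves_tree_path[OF \<sigma>, of i k] i k by auto
      then show ?thesis
        using tree_parent_in(2)[OF \<sigma> k] by auto
    qed
    ultimately show "v \<in> tree_leaves n \<sigma>"
      by (auto simp: tree_leaves_def)
  qed
  moreover have "n \<notin> descents n \<sigma>"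
    by (simp add: descents_def)
  ultimately show ?thesis
    by (simp only: card_image[OF Sym_inj_on[OF \<sigma>]]) (simp add: finite_descents)
qed

lemma balanced_tree_leaves:
  assumes "1 \<le> n"
  shows "balanced n (\<lambda>\<sigma>. int (card (tree_leaves n \<sigma>)))"
proof -
  have "balanced n (\<lambda>\<sigma>. int (card (descents n \<sigma>)) + 1)"
    by (intro balanced_add balanced_descents balanced_const)
  then show ?thesis
    using card_tree_leaves[OF _ assms]
    by (subst balanced_cong[where g = "\<lambda>\<sigma>. int (card (descents n \<sigma>)) + 1"]) simp_all
qed

theorem theorem4p6:
  fixes n :: nat
  assumes "n \<ge> 1"
  shows "\<forall>f \<in> set [
    \<lambda>\<sigma>. int (card (inversions n \<sigma>)),
    \<lambda>\<sigma>. int (card (noninversions n \<sigma>)),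
    \<lambda>\<sigma>. int (card {(i, j) \<in> inversions n \<sigma>. j - i \<le> 2}),
    \<lambda>\<sigma>. int (card {j \<in> {3<..n}. \<sigma> j < \<sigma> 3}),
    \<lambda>\<sigma>. int (card {j \<in> {2<..n}. \<sigma> j < \<sigma> 2}),
    \<lambda>\<sigma>. int (major_index n \<sigma>),
    \<lambda>\<sigma>. int (card (descents n \<sigma>)),
    \<lambda>\<sigma>. int (card (peaks n \<sigma>)),
    \<lambda>\<sigma>. int (card (left_outer_peaks n \<sigma>)),
    \<lambda>\<sigma>. int (num_outer_peaks n \<sigma>),
    \<lambda>\<sigma>. int (num_valleys_with_boundary n \<sigma>),
    \<lambda>\<sigma>. int (card (ascents n \<sigma>)),
    \<lambda>\<sigma>. int (card (valleys n \<sigma>)),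
    \<lambda>\<sigma>. int (card (double_ascents n \<sigma>)),
    \<lambda>\<sigma>. int (card (double_descents n \<sigma>)),
    \<lambda>\<sigma>. int (card (runs n \<sigma>)),
    \<lambda>\<sigma>. int (card (peaks n \<sigma>) + card (valleys n \<sigma>)),
    \<lambda>\<sigma>. int (num_updown_runs n \<sigma>),
    \<lambda>\<sigma>. int (comajor_index n \<sigma>),
    \<lambda>\<sigma>. int (card (right_outer_peaks n \<sigma>)),
    \<lambda>\<sigma>. int (card (descents_dist2 n \<sigma>)),
    \<lambda>\<sigma>. int (card (ascents_dist2 n \<sigma>)),
    \<lambda>\<sigma>. int (card {i \<in> descents n \<sigma>. odd i}),
    \<lambda>\<sigma>. int (card {i \<in> descents n \<sigma>. even i}),
    \<lambda>\<sigma>. int (card (vinc_occurrences [2, 1, 3] n \<sigma>)),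
    \<lambda>\<sigma>. int (card (vinc_occurrences [1, 3, 2] n \<sigma>)),
    \<lambda>\<sigma>. int (card (vinc_occurrences [1, 2, 3] n \<sigma>)),
    \<lambda>\<sigma>. int (card (vinc_occurrences [3, 1, 2] n \<sigma>)),
    \<lambda>\<sigma>. int (card (vinc_occurrences [2, 3, 1] n \<sigma>)),
    \<lambda>\<sigma>. int (card (vinc_occurrences [3, 2, 1] n \<sigma>)),
    \<lambda>\<sigma>. int (card (occurrences [1, 2, 3] n \<sigma>) + card (occurrences [1, 3, 2] n \<sigma>)),
    \<lambda>\<sigma>. int (card (occurrences [2, 1, 3] n \<sigma>) + card (occurrences [2, 3, 1] n \<sigma>)),
    \<lambda>\<sigma>. int (card (occurrences [3, 1, 2] n \<sigma>) + card (occurrences [3, 2, 1] n \<sigma>)),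
    \<lambda>\<sigma>. int (card (occurrences_14_23 n \<sigma>)),
    \<lambda>\<sigma>. int (card (occurrences_initial_123 n \<sigma>)),
    \<lambda>\<sigma>. int (card (rl_maxima n \<sigma>)),
    \<lambda>\<sigma>. int (lex_rank n \<sigma>),
    \<lambda>\<sigma>. int (\<sigma> 1),
    \<lambda>\<sigma>. int (card (tree_leaves n \<sigma>)),
    \<lambda>\<sigma>. int (bs_stat n \<sigma>),
    \<lambda>\<sigma>. int (bs_stat' n \<sigma>),
    \<lambda>\<sigma>. int (card (rl_minima n \<sigma>)),
    \<lambda>\<sigma>. int (major_index n \<sigma>) - int (card (inversions n \<sigma>)),
    \<lambda>\<sigma>. int (card (inversions n \<sigma>)) + int (major_index n \<sigma>),
    \<lambda>\<sigma>. int (card {i \<in> ascent_tops n \<sigma>. \<forall>v\<in>{1..<\<sigma> i}. \<exists>j\<in>{1..<i}. \<sigma> j = v})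
  ]. homomesic (Sym n) (lehmer_rotation n) f"
  \<comment> \<open>The list becomes a conjunction with one goal per statistic.
    \<open>balanced_entry_inversions\<close> serves the second and the third entry, with bounds on
    the position as side conditions, and \<open>balanced_descents_filter\<close> serves both
    parities.\<close>
  unfolding list.set ball_simps
  by (intro conjI TrueI balanced_imp_homomesic
      balanced_inversions balanced_noninversions balanced_short_inversions balanced_entry_inversions
      balanced_major_index balanced_descents balanced_peaks balanced_left_outer_peaks
      balanced_num_outer_peaks balanced_num_valleys_with_boundary balanced_ascents balanced_valleys
      balanced_double_ascents balanced_double_descents balanced_runs balanced_switches
      balanced_num_updown_runs balanced_comajor_index balanced_right_outer_peaks
      balanced_descents_dist2 balanced_ascents_dist2 balanced_descents_filter
      balanced_vinc_213 balanced_vinc_132 balanced_vinc_123 balanced_vinc_312 balanced_vinc_231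
      balanced_vinc_321 balanced_123_132 balanced_213_231 balanced_312_321
      balanced_occurrences_14_23 balanced_initial_123 balanced_rl_maxima balanced_lex_rank
      balanced_first_entry balanced_tree_leaves balanced_bs_stat balanced_bs_stat'
      balanced_rl_minima balanced_complete_ascent_tops balanced_diff balanced_add assms) simp_all

end
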